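(* Let $n\ge 3$, let $P$ be a compact Coxeter polytope in $\mathbb{H}^n$, let $O$ be an interior point of $P$, and let $E$ be an outermost edge of $P$ relative to $O$. If the ridge associated with $E$ is right-angled, then its width $\mathbf{t}(n)$ satisfies $\mathbf{t}(n)<\frac{n+1}{n-1}$. In particular, every compact right-angled Coxeter polytope in $\mathbb{H}^n$ has a ridge of width less than $\frac{n+1}{n-1}$.
   Context: A Coxeter polytope in hyperbolic space $\mathbb{H}^n$ (metric $\rho$) is a convex polytope all of whose dihedral angles are of the form $\pi/k$, $k\ge2$ an integer; it is right-angled if all its dihedral angles equal $\pi/2$. Facets are faces of codimension 1. For an edge $E$, let $F_1,\dots,F_{n-1}$ be the facets containing $E$ and $F_n,F_{n+1}$ the framing facets of $E$ (the facets containing a vertex of $E$ but not $E$). The ridge associated with $E$ is $\{F_1,\dots,F_{n+1}\}$; its width is $\cosh\rho(F_n,F_{n+1})$. The ridge is right-angled if the dihedral angle between $F_i$ and $F_j$ equals $\pi/2$ for all pairs $1\le i<j\le n+1$ with $\{i,j\}\neq\{n,n+1\}$. An edge $E$ is outermost relative to $O$ if $\rho(O,E)=\max_{E'}\rho(O,E')$ over all edges $E'$ of $P$. *)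

theory Defs
  imports "HOL-Analysis.Analysis"
begin

text \<open>Model: hyperbolic n-space H^n is realised by the Beltrami--Klein model,
  the open Euclidean unit ball of real^'n, with n = CARD('n).  In this model
  hyperbolic geodesics are Euclidean straight segments, so hyperbolic convex
  polytopes are exactly Euclidean convex polytopes; a compact polytope of H^n is
  a Euclidean polytope contained in the open unit ball.\<close>

definition hdist :: "real^'n \<Rightarrow> real^'n \<Rightarrow> real" where
  "hdist x y = arcosh ((1 - x \<bullet> y) / sqrt ((1 - (norm x)\<^sup>2) * (1 - (norm y)\<^sup>2)))"

definition hsetdist :: "(real^'n) set \<Rightarrow> (real^'n) set \<Rightarrow> real" where
  "hsetdist A B = Inf {hdist x y | x y. x \<in> A \<and> y \<in> B}"

definition compact_hyp_polytope :: "(real^'n) set \<Rightarrow> bool" where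
  "compact_hyp_polytope P \<longleftrightarrow> polytope P \<and> P \<subseteq> ball 0 1 \<and> interior P \<noteq> {}"

text \<open>An outward normal of a facet: the facet is F = P \<inter> {a.x = b} with
  P \<subseteq> {a.x \<le> b}.  The corresponding hyperbolic half-space {a.x \<le> b}
  has Lorentzian (spacelike) outward normal (a,b) in R^{n,1}.\<close>
definition facet_normal :: "(real^'n) set \<Rightarrow> (real^'n) set \<Rightarrow> (real^'n) \<times> real" where
  "facet_normal P F = (SOME (a, b). a \<noteq> 0 \<and> P \<subseteq> {x. a \<bullet> x \<le> b} \<and> F = P \<inter> {x. a \<bullet> x = b})"

definition lorentz :: "(real^'n) \<times> real \<Rightarrow> (real^'n) \<times> real \<Rightarrow> real" where
  "lorentz u v = fst u \<bullet> fst v - snd u * snd v"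

text \<open>Dihedral angle between two facets (standard Gram-matrix formula:
  cos of the angle = - <e_F, e_G> for unit outward normals).\<close>
definition dihedral_angle :: "(real^'n) set \<Rightarrow> (real^'n) set \<Rightarrow> (real^'n) set \<Rightarrow> real" where
  "dihedral_angle P F G =
     arccos (- lorentz (facet_normal P F) (facet_normal P G)
       / (sqrt (lorentz (facet_normal P F) (facet_normal P F))
          * sqrt (lorentz (facet_normal P G) (facet_normal P G))))"

definition adjacent_facets :: "(real^'n) set \<Rightarrow> (real^'n) set \<Rightarrow> (real^'n) set \<Rightarrow> bool" where
  "adjacent_facets P F G \<longleftrightarrow> F facet_of P \<and> G facet_of P \<and> F \<noteq> G
     \<and> aff_dim (F \<inter> G) = aff_dim P - 2"

definition coxeter_polytope :: "(real^'n) set \<Rightarrow> bool" where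
  "coxeter_polytope P \<longleftrightarrow>
     (\<forall>F G. adjacent_facets P F G \<longrightarrow> (\<exists>k::nat. k \<ge> 2 \<and> dihedral_angle P F G = pi / real k))"

definition right_angled_polytope :: "(real^'n) set \<Rightarrow> bool" where
  "right_angled_polytope P \<longleftrightarrow>
     (\<forall>F G. adjacent_facets P F G \<longrightarrow> dihedral_angle P F G = pi / 2)"

definition edge_facets :: "(real^'n) set \<Rightarrow> (real^'n) set \<Rightarrow> (real^'n) set set" where
  "edge_facets P E = {F. F facet_of P \<and> E \<subseteq> F}"

definition framing_facets :: "(real^'n) set \<Rightarrow> (real^'n) set \<Rightarrow> (real^'n) set set" where
  "framing_facets P E =
     {F. F facet_of P \<and> \<not> E \<subseteq> F \<and> (\<exists>v. v extreme_point_of E \<and> v \<in> F)}"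

definition right_angled_ridge :: "(real^'n) set \<Rightarrow> (real^'n) set \<Rightarrow> bool" where
  "right_angled_ridge P E \<longleftrightarrow>
     (\<forall>F \<in> edge_facets P E \<union> framing_facets P E.
       \<forall>G \<in> edge_facets P E \<union> framing_facets P E.
         F \<noteq> G \<and> \<not> (F \<in> framing_facets P E \<and> G \<in> framing_facets P E)
           \<longrightarrow> dihedral_angle P F G = pi / 2)"

definition ridge_width :: "(real^'n) set \<Rightarrow> (real^'n) set \<Rightarrow> real" where
  "ridge_width F G = cosh (hsetdist F G)"

definition outermost_edge :: "(real^'n) set \<Rightarrow> real^'n \<Rightarrow> (real^'n) set \<Rightarrow> bool" where
  "outermost_edge P c E \<longleftrightarrow> E edge_of P \<and>
     (\<forall>E'. E' edge_of P \<longrightarrow> hsetdist {c} E' \<le> hsetdist {c} E)"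

end

theory Submission
  imports Defs
begin

text \<open>
  Represent the points of the ball by the vectors \<open>(x, 1)\<close> of Minkowski space. If the ridge of the
  edge \<open>E = [v, w]\<close> is right-angled, then the normals of the facets through \<open>E\<close> and of the framing
  facet at \<open>v\<close> are orthogonal. Hence \<open>sinh\<^sup>2\<close> of the distance from \<open>c\<close> to \<open>E\<close> is the sum of the
  squared coordinates of \<open>c\<close> along the normals of the facets through \<open>E\<close>; exchanging one of these
  facets for the framing facet gives a lower bound for the distance to a neighbouring edge at \<open>v\<close>. As \<open>E\<close> is
  outermost, the squared coordinates along the framing facets are at most those along each of the
  \<open>n - 1\<close> facets through \<open>E\<close>. Comparing with the norm of the orthogonal projection of \<open>c\<close> to the
  Minkowski plane spanned by \<open>v\<close> and \<open>w\<close> bounds \<open>cosh\<close> of the length of \<open>E\<close>.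

  In a right-angled polytope the orthogonal projection to the hyperplane of a facet maps the polytope into that
  facet. This forces any two facet normals to have a nonpositive product, so the normals of the
  facets through a vertex are linearly independent, the facets through a vertex are pairwise
  adjacent, and every ridge is right-angled.
\<close>

section \<open>Minkowski space and hyperbolic distance\<close>

definition lift :: "real^'n \<Rightarrow> (real^'n) \<times> real" where
  "lift x = (x, 1)"

lemma lorentz_commute: "lorentz u v = lorentz v u"
  by (simp add: lorentz_def inner_commute mult.commute)

lemma lorentz_add_left: "lorentz (u + v) w = lorentz u w + lorentz v w"
  by (simp add: lorentz_def algebra_simps)

lemma lorentz_add_right: "lorentz w (u + v) = lorentz w u + lorentz w v"
  by (simp add: lorentz_def algebra_simps)

lemma lorentz_diff_left: "lorentz (u - v) w = lorentz u w - lorentz v w"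
  by (simp add: lorentz_def algebra_simps)

lemma lorentz_diff_right: "lorentz w (u - v) = lorentz w u - lorentz w v"
  by (simp add: lorentz_def algebra_simps)

lemma lorentz_scaleR_left: "lorentz (r *\<^sub>R u) w = r * lorentz u w"
  by (simp add: lorentz_def algebra_simps)

lemma lorentz_scaleR_right: "lorentz w (r *\<^sub>R u) = r * lorentz w u"
  by (simp add: lorentz_def algebra_simps)

lemma lorentz_zero_left [simp]: "lorentz 0 w = 0"
  by (simp add: lorentz_def)

lemma lorentz_zero_right [simp]: "lorentz w 0 = 0"
  by (simp add: lorentz_def)

lemma lorentz_sum_left: "lorentz (\<Sum>i\<in>I. f i) w = (\<Sum>i\<in>I. lorentz (f i) w)"
  by (induction I rule: infinite_finite_induct) (simp_all add: lorentz_add_left)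

lemma lorentz_sum_right: "lorentz w (\<Sum>i\<in>I. f i) = (\<Sum>i\<in>I. lorentz w (f i))"
  by (induction I rule: infinite_finite_induct) (simp_all add: lorentz_add_right)

lemmas lorentz_linear =
  lorentz_add_left lorentz_add_right lorentz_diff_left lorentz_diff_right
  lorentz_scaleR_left lorentz_scaleR_right

lemma lorentz_lift: "lorentz u (lift x) = fst u \<bullet> x - snd u"
  by (simp add: lorentz_def lift_def)

lemma lorentz_lift_lift: "lorentz (lift x) (lift y) = - (1 - x \<bullet> y)"
  by (simp add: lorentz_def lift_def)

lemma one_minus_norm_sq_pos: "x \<in> ball 0 1 \<Longrightarrow> 0 < 1 - (norm x)\<^sup>2"
  by (simp add: abs_square_less_1)

lemma one_minus_inner_pos:
  assumes "x \<in> ball 0 1" "y \<in> ball 0 1"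
  shows "0 < 1 - x \<bullet> y"
proof -
  have "x \<bullet> y \<le> norm x * norm y"
    by (rule norm_cauchy_schwarz)
  also have "\<dots> < 1"
    using assms mult_strict_mono'[of "norm x" 1 "norm y" 1] by simp
  finally show ?thesis by simp
qed

text \<open>Writing \<open>w = (u, s)\<close>, the claim follows from the identity \<open>(|s| -
  |u||y|)^2 - (s^2 - |u|^2)(1 - |y|^2) = (|s||y| - |u|)^2\<close> and the bounds
  \<open>0 <= |s| - |u||y| <= |u \<bullet> y - s|\<close>.\<close>

lemma reverse_cauchy_schwarz:
  assumes "y \<in> ball 0 1" "lorentz w w < 0"
  shows "(- lorentz w w) * (1 - (norm y)\<^sup>2) \<le> (lorentz w (lift y))\<^sup>2"
proof -
  define u s where "u = fst w" and "s = snd w"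
  have ws: "lorentz w w = (norm u)\<^sup>2 - s\<^sup>2"
    by (simp add: lorentz_def u_def s_def dot_square_norm power2_eq_square)
  have "\<bar>norm u\<bar> < \<bar>s\<bar>"
    using assms(2) ws abs_le_square_iff[of s "norm u"] by linarith
  then have us: "norm u < \<bar>s\<bar>" by simp
  have "norm u * norm y \<le> \<bar>s\<bar> * 1"
    using us assms(1) by (intro mult_mono) auto
  then have nonneg: "0 \<le> \<bar>s\<bar> - norm u * norm y" by simp
  have "\<bar>u \<bullet> y\<bar> \<le> norm u * norm y"
    by (rule Cauchy_Schwarz_ineq2)
  then have "\<bar>s\<bar> - norm u * norm y \<le> \<bar>u \<bullet> y - s\<bar>" by linarith
  then have "(\<bar>s\<bar> - norm u * norm y)\<^sup>2 \<le> (u \<bullet> y - s)\<^sup>2"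
    using nonneg by (simp add: abs_le_square_iff[symmetric])
  moreover have "(\<bar>s\<bar> - norm u * norm y)\<^sup>2 - (s\<^sup>2 - (norm u)\<^sup>2) * (1 - (norm y)\<^sup>2)
      = (\<bar>s\<bar> * norm y - norm u)\<^sup>2"
    by (simp add: power2_eq_square algebra_simps)
  moreover have "0 \<le> (\<bar>s\<bar> * norm y - norm u)\<^sup>2" by simp
  moreover have "lorentz w (lift y) = u \<bullet> y - s"
    by (simp add: lorentz_lift u_def s_def)
  ultimately show ?thesis
    unfolding ws by (smt (verit, best))
qed

text \<open>The form is positive definite on the complement of a timelike vector: here
  \<open>snd u = fst u \<bullet> v\<close>, which is smaller in absolute value than
  \<open>norm (fst u)\<close> because \<open>norm v < 1\<close>.\<close>

lemma lorentz_pos_of_orthogonal_lift: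
  assumes "v \<in> ball 0 1" "lorentz u (lift v) = 0" "u \<noteq> 0"
  shows "0 < lorentz u u"
proof -
  have s: "snd u = fst u \<bullet> v"
    using assms(2) by (simp add: lorentz_lift)
  then have "fst u \<noteq> 0"
    using assms(3) by (auto simp: prod_eq_iff)
  have "\<bar>fst u \<bullet> v\<bar> \<le> norm (fst u) * norm v"
    by (rule Cauchy_Schwarz_ineq2)
  also have "\<dots> < norm (fst u)"
    using assms(1) \<open>fst u \<noteq> 0\<close> by simp
  finally have "(fst u \<bullet> v)\<^sup>2 < (norm (fst u))\<^sup>2"
    using abs_le_square_iff[of "norm (fst u)" "fst u \<bullet> v"] by simp
  then show ?thesis
    by (simp add: lorentz_def s dot_square_norm power2_eq_square)
qed

text \<open>By positivity on the complement of \<open>lift v\<close> the usual argument with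
  \<open>u - r *\<^sub>R w\<close> applies. This later places the argument of \<open>arccos\<close>
  in a dihedral angle between -1 and 1.\<close>

lemma lorentz_cauchy_schwarz:
  assumes "v \<in> ball 0 1" "lorentz u (lift v) = 0" "lorentz w (lift v) = 0"
  shows "(lorentz u w)\<^sup>2 \<le> lorentz u u * lorentz w w"
proof (cases "w = 0")
  case True
  then show ?thesis by simp
next
  case False
  then have pos: "0 < lorentz w w"
    using assms lorentz_pos_of_orthogonal_lift by blast
  define r where "r = lorentz u w / lorentz w w"
  have "0 \<le> lorentz (u - r *\<^sub>R w) (u - r *\<^sub>R w)"
    using lorentz_pos_of_orthogonal_lift[OF assms(1), of "u - r *\<^sub>R w"] assms(2,3)
    by (cases "u - r *\<^sub>R w = 0") (auto simp: lorentz_diff_left lorentz_scaleR_left)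
  also have "\<dots> = lorentz u u - (lorentz u w)\<^sup>2 / lorentz w w"
    using pos unfolding lorentz_linear
    by (simp add: r_def lorentz_commute[of w u] field_simps power2_eq_square)
  finally show ?thesis
    using pos by (simp add: field_simps)
qed

lemma one_minus_inner_square_ge:
  fixes x y :: "real^'n"
  assumes "x \<in> ball 0 1" "y \<in> ball 0 1"
  shows "(1 - (norm x)\<^sup>2) * (1 - (norm y)\<^sup>2) \<le> (1 - x \<bullet> y)\<^sup>2"
  using reverse_cauchy_schwarz[OF assms(2), of "lift x"] one_minus_norm_sq_pos[OF assms(1)]
  by (simp add: lorentz_lift_lift dot_square_norm power2_commute)

section \<open>Comparing hyperbolic distances through their cosh\<close>

definition coshdist :: "real^'n \<Rightarrow> real^'n \<Rightarrow> real" where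
  "coshdist x y = (1 - x \<bullet> y) / sqrt ((1 - (norm x)\<^sup>2) * (1 - (norm y)\<^sup>2))"

lemma hdist_eq_arcosh: "hdist x y = arcosh (coshdist x y)"
  by (simp add: hdist_def coshdist_def)

lemma coshdist_sq:
  assumes "x \<in> ball 0 1" "y \<in> ball 0 1"
  shows "(coshdist x y)\<^sup>2 = (1 - x \<bullet> y)\<^sup>2 / ((1 - (norm x)\<^sup>2) * (1 - (norm y)\<^sup>2))"
  using one_minus_norm_sq_pos[OF assms(1)] one_minus_norm_sq_pos[OF assms(2)]
  by (simp add: coshdist_def power_divide)

lemma coshdist_ge_1:
  assumes "x \<in> ball 0 1" "y \<in> ball 0 1"
  shows "1 \<le> coshdist x y"
proof -
  have "0 < coshdist x y"
    using one_minus_inner_pos[OF assms] one_minus_norm_sq_pos[OF assms(1)]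
      one_minus_norm_sq_pos[OF assms(2)] by (simp add: coshdist_def)
  moreover have "1 \<le> (coshdist x y)\<^sup>2"
    unfolding coshdist_sq[OF assms]
    using one_minus_inner_square_ge[OF assms] one_minus_norm_sq_pos[OF assms(1)]
      one_minus_norm_sq_pos[OF assms(2)] by simp
  ultimately show ?thesis
    using abs_le_square_iff[of 1 "coshdist x y"] by simp
qed

lemma hdist_nonneg:
  assumes "x \<in> ball 0 1" "y \<in> ball 0 1"
  shows "0 \<le> hdist x y"
  by (simp add: hdist_eq_arcosh coshdist_ge_1[OF assms])

lemma hsetdist_le:
  assumes "A \<subseteq> ball 0 1" "B \<subseteq> ball 0 1" "x \<in> A" "y \<in> B"
  shows "hsetdist A B \<le> hdist x y"
  unfolding hsetdist_def
  by (rule cInf_lower) (use assms in \<open>auto intro!: bdd_belowI[of _ 0] hdist_nonneg\<close>)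

lemma hsetdist_nonneg:
  assumes "A \<subseteq> ball 0 1" "B \<subseteq> ball 0 1" "A \<noteq> {}" "B \<noteq> {}"
  shows "0 \<le> hsetdist A B"
  unfolding hsetdist_def
  by (rule cInf_greatest) (use assms in \<open>auto intro!: hdist_nonneg\<close>)

lemma cosh_hsetdist_le:
  assumes "A \<subseteq> ball 0 1" "B \<subseteq> ball 0 1" "x \<in> A" "y \<in> B"
  shows "cosh (hsetdist A B) \<le> coshdist x y"
proof -
  have xy: "x \<in> ball 0 1" "y \<in> ball 0 1"
    using assms by auto
  have "cosh (hsetdist A B) \<le> cosh (hdist x y)"
    using hsetdist_le[OF assms] hsetdist_nonneg[OF assms(1,2)] hdist_nonneg[OF xy] assms(3,4)
    by (subst cosh_real_nonneg_le_iff) auto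
  then show ?thesis
    by (simp add: hdist_eq_arcosh coshdist_ge_1[OF xy])
qed

section \<open>Orthogonal systems of spacelike vectors and feet of perpendiculars\<close>

definition lorentz_orthogonal :: "((real^'n) \<times> real) set \<Rightarrow> bool" where
  "lorentz_orthogonal S \<longleftrightarrow> finite S \<and> (\<forall>u\<in>S. 0 < lorentz u u)
     \<and> (\<forall>u\<in>S. \<forall>v\<in>S. u \<noteq> v \<longrightarrow> lorentz u v = 0)"

lemma lorentz_orthogonal_subset: "lorentz_orthogonal S \<Longrightarrow> T \<subseteq> S \<Longrightarrow> lorentz_orthogonal T"
  unfolding lorentz_orthogonal_def by (meson finite_subset subsetD)

text \<open>The squared coordinate of \<open>z\<close> along the normalised vector \<open>u\<close>.
  The quotient is invariant under rescaling of \<open>u\<close>, so facet normals of any length can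
  be inserted.\<close>

definition coord_sq :: "(real^'n) \<times> real \<Rightarrow> (real^'n) \<times> real \<Rightarrow> real" where
  "coord_sq z u = (lorentz z u)\<^sup>2 / lorentz u u"

text \<open>For an orthogonal system \<open>S\<close> this is the component of \<open>z\<close>
  orthogonal to \<open>S\<close>. With \<open>z = lift c\<close> it represents, up to scaling, the
  foot of the perpendicular from \<open>c\<close> to the subspace cut out by
  \<open>S\<close>.\<close>

definition residual :: "(real^'n) \<times> real \<Rightarrow> ((real^'n) \<times> real) set \<Rightarrow> (real^'n) \<times> real" where
  "residual z S = z - (\<Sum>u\<in>S. (lorentz z u / lorentz u u) *\<^sub>R u)"

lemma lorentz_residual_in:
  assumes "lorentz_orthogonal S" "v \<in> S"
  shows "lorentz (residual z S) v = 0"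
proof -
  have fin: "finite S" and pos: "0 < lorentz v v"
    using assms by (auto simp: lorentz_orthogonal_def)
  have "lorentz (\<Sum>u\<in>S. (lorentz z u / lorentz u u) *\<^sub>R u) v
      = (\<Sum>u\<in>S. if u = v then lorentz z v else 0)"
    unfolding lorentz_sum_left lorentz_scaleR_left
    using assms pos by (intro sum.cong) (auto simp: lorentz_orthogonal_def)
  also have "\<dots> = lorentz z v"
    using assms(2) fin by simp
  finally show ?thesis
    by (simp add: residual_def lorentz_diff_left)
qed

lemma lorentz_residual_orthogonal:
  assumes "\<And>u. u \<in> S \<Longrightarrow> lorentz u v = 0"
  shows "lorentz (residual z S) v = lorentz z v"
  using assms by (simp add: residual_def lorentz_diff_left lorentz_sum_left lorentz_scaleR_left)

lemma lorentz_residual_self: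
  assumes "lorentz_orthogonal S"
  shows "lorentz (residual z S) (residual z S) = lorentz z z - (\<Sum>u\<in>S. coord_sq z u)"
proof -
  let ?p = "\<Sum>u\<in>S. (lorentz z u / lorentz u u) *\<^sub>R u"
  have "lorentz u (residual z S) = 0" if "u \<in> S" for u
    using lorentz_residual_in[OF assms that] by (simp add: lorentz_commute)
  then have "lorentz ?p (residual z S) = 0"
    by (simp add: lorentz_sum_left lorentz_scaleR_left)
  then have "lorentz (residual z S) (residual z S) = lorentz z (residual z S)"
    unfolding residual_def[of z S] lorentz_diff_left[of z] by simp
  also have "\<dots> = lorentz (residual z S) z"
    by (rule lorentz_commute)
  also have "\<dots> = lorentz z z - lorentz ?p z"
    by (simp add: residual_def lorentz_diff_left)
  also have "lorentz ?p z = (\<Sum>u\<in>S. coord_sq z u)"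
    unfolding lorentz_sum_left lorentz_scaleR_left coord_sq_def
    by (intro sum.cong) (simp_all add: lorentz_commute[of z] power2_eq_square)
  finally show ?thesis .
qed

lemma coord_sq_nonneg: "lorentz_orthogonal S \<Longrightarrow> u \<in> S \<Longrightarrow> 0 \<le> coord_sq z u"
  by (auto simp: coord_sq_def lorentz_orthogonal_def intro: divide_nonneg_pos)

text \<open>The residual has the same product with \<open>lift y\<close> as \<open>lift c\<close>
  has, while its norm is \<open>-(Q + K)\<close>. The reverse Cauchy-Schwarz inequality then gives
  \<open>cosh^2 >= 1 + K / Q\<close> for every \<open>y\<close> in \<open>E\<close>.\<close>

lemma hsetdist_ge_of_orthogonal:
  assumes S: "lorentz_orthogonal S" and c: "c \<in> ball 0 1"
    and E: "E \<subseteq> ball 0 1" "E \<noteq> {}"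
    and orth: "\<And>u y. u \<in> S \<Longrightarrow> y \<in> E \<Longrightarrow> lorentz u (lift y) = 0"
  shows "arcosh (sqrt (1 + (\<Sum>u\<in>S. coord_sq (lift c) u) / (1 - (norm c)\<^sup>2))) \<le> hsetdist {c} E"
  unfolding hsetdist_def
proof (rule cInf_greatest)
  show "{hdist x y |x y. x \<in> {c} \<and> y \<in> E} \<noteq> {}"
    using E by auto
next
  fix d assume "d \<in> {hdist x y |x y. x \<in> {c} \<and> y \<in> E}"
  then obtain y where y: "y \<in> E" and d: "d = hdist c y" by auto
  let ?r = "residual (lift c) S" and ?K = "\<Sum>u\<in>S. coord_sq (lift c) u"
  let ?Q = "1 - (norm c)\<^sup>2"
  have K: "0 \<le> ?K"
    using coord_sq_nonneg[OF S] by (simp add: sum_nonneg)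
  have Q: "0 < ?Q" using c by (rule one_minus_norm_sq_pos)
  have yb: "y \<in> ball 0 1" using y E by auto
  have rr: "lorentz ?r ?r = - (?Q + ?K)"
    by (simp add: lorentz_residual_self[OF S] lorentz_lift_lift dot_square_norm)
  have ry: "lorentz ?r (lift y) = - (1 - c \<bullet> y)"
    using lorentz_residual_orthogonal[of S "lift y" "lift c"] orth y by (simp add: lorentz_lift_lift)
  have "(?Q + ?K) * (1 - (norm y)\<^sup>2) \<le> (1 - c \<bullet> y)\<^sup>2"
    using reverse_cauchy_schwarz[OF yb, of ?r] Q K unfolding rr ry power2_minus minus_minus by simp
  then have "?Q + ?K \<le> (1 - c \<bullet> y)\<^sup>2 / (1 - (norm y)\<^sup>2)"
    using one_minus_norm_sq_pos[OF yb] by (simp only: pos_le_divide_eq)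
  then have "(?Q + ?K) / ?Q \<le> (1 - c \<bullet> y)\<^sup>2 / (1 - (norm y)\<^sup>2) / ?Q"
    using Q by (intro divide_right_mono) auto
  then have "1 + ?K / ?Q \<le> (coshdist c y)\<^sup>2"
    unfolding coshdist_sq[OF c yb] using Q by (simp add: add_divide_distrib mult.commute)
  then have "sqrt (1 + ?K / ?Q) \<le> coshdist c y"
    using coshdist_ge_1[OF c yb] by (simp add: real_le_lsqrt)
  moreover have "1 \<le> sqrt (1 + ?K / ?Q)"
    using K Q by simp
  ultimately show "arcosh (sqrt (1 + ?K / ?Q)) \<le> d"
    using d coshdist_ge_1[OF c yb] arcosh_less_iff_real[of "coshdist c y" "sqrt (1 + ?K / ?Q)"]
    unfolding hdist_eq_arcosh by linarith
qed

text \<open>The case of equality in the preceding bound: \<open>p\<close> is the foot of the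
  perpendicular, and both \<open>s^2 (1 - |p|^2) = Q + K\<close> and
  \<open>1 - c \<bullet> p = s (1 - |p|^2)\<close> can be read off the residual.\<close>

lemma hdist_residual:
  assumes S: "lorentz_orthogonal S" and c: "c \<in> ball 0 1" and p: "p \<in> ball 0 1"
    and s: "0 < s" and res: "residual (lift c) S = s *\<^sub>R lift p"
  shows "hdist c p = arcosh (sqrt (1 + (\<Sum>u\<in>S. coord_sq (lift c) u) / (1 - (norm c)\<^sup>2)))"
proof -
  let ?r = "residual (lift c) S" and ?K = "\<Sum>u\<in>S. coord_sq (lift c) u"
  let ?Q = "1 - (norm c)\<^sup>2"
  have Q: "0 < ?Q" using c by (rule one_minus_norm_sq_pos)
  have q: "0 < 1 - (norm p)\<^sup>2" using p by (rule one_minus_norm_sq_pos)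
  have rr: "lorentz ?r ?r = - (?Q + ?K)"
    by (simp add: lorentz_residual_self[OF S] lorentz_lift_lift dot_square_norm)
  then have QK: "s * s * (1 - (norm p)\<^sup>2) = ?Q + ?K"
    unfolding res by (simp add: lorentz_linear lorentz_lift_lift dot_square_norm algebra_simps)
  have orth: "lorentz u (lift p) = 0" if "u \<in> S" for u
  proof -
    have "s * lorentz (lift p) u = 0"
      using lorentz_residual_in[OF S that, of "lift c"] unfolding res lorentz_scaleR_left .
    then show ?thesis using s by (simp add: lorentz_commute)
  qed
  have "lorentz ?r (lift p) = - (1 - c \<bullet> p)"
    using lorentz_residual_orthogonal[of S "lift p" "lift c"] orth by (simp add: lorentz_lift_lift)
  then have cp: "1 - c \<bullet> p = s * (1 - (norm p)\<^sup>2)"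
    unfolding res by (simp add: lorentz_linear lorentz_lift_lift dot_square_norm algebra_simps)
  have "(coshdist c p)\<^sup>2 = s * s * (1 - (norm p)\<^sup>2) / ?Q"
    unfolding coshdist_sq[OF c p] cp using Q q by (simp add: power2_eq_square)
  then have "(coshdist c p)\<^sup>2 = 1 + ?K / ?Q"
    unfolding QK using Q by (simp add: add_divide_distrib)
  then have "coshdist c p = sqrt (1 + ?K / ?Q)"
    using coshdist_ge_1[OF c p] by (intro real_sqrt_unique[symmetric]) auto
  then show ?thesis
    by (simp add: hdist_eq_arcosh)
qed

section \<open>Facets of hyperbolic polytopes\<close>

text \<open>The ray from \<open>c\<close> towards \<open>y\<close> leaves \<open>S\<close> through
  its relative frontier, which is covered by facets, and it does so before \<open>y\<close> because
  \<open>y\<close> lies outside \<open>S\<close>.\<close>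

lemma polytope_exit_facet:
  fixes S :: "'a::euclidean_space set"
  assumes S: "polytope S" and c: "c \<in> rel_interior S" and y: "y \<in> affine hull S" "y \<notin> S"
  obtains K t where "K facet_of S" "0 < t" "t < 1" "c + t *\<^sub>R (y - c) \<in> K"
proof -
  have bd: "bounded S" and cl: "closed S" and poly: "polyhedron S"
    using S by (auto intro: polytope_imp_bounded polytope_imp_closed polytope_imp_polyhedron)
  have cS: "c \<in> S" using c rel_interior_subset by auto
  then have "y - c \<noteq> 0" using y by auto
  then obtain d where d: "0 < d" "c + d *\<^sub>R (y - c) \<in> rel_frontier S"
      "\<And>e. \<lbrakk>0 \<le> e; e < d\<rbrakk> \<Longrightarrow> c + e *\<^sub>R (y - c) \<in> rel_interior S"
    using ray_to_rel_frontier[OF bd c, of "y - c"] y by auto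
  have dS: "c + d *\<^sub>R (y - c) \<in> S - rel_interior S"
    using d(2) cl by (simp add: rel_frontier_def)
  have "d < 1"
  proof (rule ccontr)
    assume "\<not> d < 1"
    then consider "1 < d" | "d = 1" by linarith
    then have "y \<in> S"
    proof cases
      case 1
      then show ?thesis using d(3)[of 1] rel_interior_subset by auto
    next
      case 2
      then show ?thesis using dS by simp
    qed
    then show False using y by simp
  qed
  moreover obtain K where "K facet_of S" "c + d *\<^sub>R (y - c) \<in> K"
    using dS rel_boundary_of_polyhedron[OF poly] by blast
  ultimately show ?thesis using that d(1) by blast
qed

text \<open>A facet inside another one is a face of it; proper faces drop in dimension, whereas
  facets have equal dimension.\<close>

lemma facets_subset_imp_eq:
  assumes "convex P" "F facet_of P" "G facet_of P" "F \<subseteq> G"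
  shows "F = G"
proof -
  have "F face_of G"
    using assms by (meson face_of_face facet_of_imp_face_of)
  then show ?thesis
    using face_of_aff_dim_lt[of G F] assms
    by (metis face_of_imp_convex facet_of_def less_irrefl)
qed

lemma lorentz_lift_segment_less:
  assumes "lorentz u (lift c) < 0" "lorentz u (lift y) \<le> 0" "0 < t" "t < 1"
  shows "lorentz u (lift (c + t *\<^sub>R (y - c))) < 0"
proof -
  have "lorentz u (lift (c + t *\<^sub>R (y - c))) = (1 - t) * lorentz u (lift c) + t * lorentz u (lift y)"
    by (simp add: lorentz_lift algebra_simps)
  moreover have "(1 - t) * lorentz u (lift c) < 0"
    using assms by (simp add: mult_pos_neg)
  moreover have "t * lorentz u (lift y) \<le> 0"
    using assms by (simp add: mult_nonneg_nonpos)
  ultimately show ?thesis by linarith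
qed

section \<open>Facet normals and the local structure of the polytope\<close>

locale hyp_polytope =
  fixes P :: "(real^'n) set"
  assumes compact_hyp_polytope: "compact_hyp_polytope P"
    and dim_ge_3: "CARD('n) \<ge> 3"
begin

lemma polytope: "polytope P" and subset_ball: "P \<subseteq> ball 0 1" and interior: "interior P \<noteq> {}"
  using compact_hyp_polytope by (auto simp: compact_hyp_polytope_def)

lemma convex: "convex P" and polyhedron: "polyhedron P"
  using polytope by (auto intro: polytope_imp_convex polytope_imp_polyhedron)

lemma affine_hull: "affine hull P = UNIV"
  using affine_hull_nonempty_interior interior by blast

lemma aff_dim: "aff_dim P = int CARD('n)"
  using affine_hull aff_dim_eq_full[of P] by simp

lemma rel_interior: "rel_interior P = interior P"
  by (simp add: affine_hull rel_interior_interior)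

lemma finite_facets: "finite {F. F facet_of P}"
  using finite_polytope_facets polytope by blast

lemma facet_neq: "F facet_of P \<Longrightarrow> F \<noteq> P"
  by auto

abbreviation nrm :: "(real^'n) set \<Rightarrow> (real^'n) \<times> real" where
  "nrm F \<equiv> facet_normal P F"

text \<open>Faces of polyhedra are exposed, so the choice in \<open>facet_normal\<close> has a
  candidate; a zero normal would make \<open>F\<close> empty or all of \<open>P\<close>.\<close>

lemma facet_normal:
  assumes "F facet_of P"
  shows "fst (nrm F) \<noteq> 0 \<and> P \<subseteq> {x. fst (nrm F) \<bullet> x \<le> snd (nrm F)}
    \<and> F = P \<inter> {x. fst (nrm F) \<bullet> x = snd (nrm F)}"
proof -
  have "F exposed_face_of P"
    using assms exposed_face_of_polyhedron[OF polyhedron] facet_of_imp_face_of by blast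
  then obtain a b where ab: "P \<subseteq> {x. a \<bullet> x \<le> b}" "F = P \<inter> {x. a \<bullet> x = b}"
    by (auto simp: exposed_face_of_def)
  have "a \<noteq> 0"
  proof
    assume "a = 0"
    then have "F = {} \<or> F = P" using ab by auto
    then show False using assms by (auto simp: facet_of_def)
  qed
  with ab have "\<exists>p. case p of (a, b) \<Rightarrow>
      a \<noteq> 0 \<and> P \<subseteq> {x. a \<bullet> x \<le> b} \<and> F = P \<inter> {x. a \<bullet> x = b}"
    by auto
  from someI_ex[OF this] show ?thesis
    by (simp add: facet_normal_def case_prod_unfold)
qed

lemma facet_normal_nonzero: "F facet_of P \<Longrightarrow> nrm F \<noteq> 0"
  using facet_normal by (metis fst_zero)

lemma lorentz_facet_le: "F facet_of P \<Longrightarrow> x \<in> P \<Longrightarrow> lorentz (nrm F) (lift x) \<le> 0"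
  using facet_normal[of F] by (auto simp: lorentz_lift)

lemma mem_facet_iff: "F facet_of P \<Longrightarrow> x \<in> F \<longleftrightarrow> x \<in> P \<and> lorentz (nrm F) (lift x) = 0"
  using facet_normal[of F] by (auto simp: lorentz_lift)

lemma lorentz_facet_less: "F facet_of P \<Longrightarrow> x \<in> P \<Longrightarrow> x \<notin> F \<Longrightarrow> lorentz (nrm F) (lift x) < 0"
  using lorentz_facet_le[of F x] mem_facet_iff[of F x] by linarith

lemma lorentz_interior_less:
  assumes "F facet_of P" "c \<in> interior P"
  shows "lorentz (nrm F) (lift c) < 0"
proof -
  have "c \<notin> F"
    using assms face_of_disjoint_interior[of F P] facet_neq facet_of_imp_face_of by blast
  then show ?thesis
    using lorentz_facet_less assms interior_subset by blast
qed

text \<open>Allows sums over normals to be rewritten as sums over facets.\<close>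

lemma facet_normal_inj: "inj_on nrm {F. F facet_of P}"
  by (rule inj_onI) (use mem_facet_iff in \<open>auto simp: set_eq_iff\<close>)

lemma facet_normal_spacelike:
  assumes "F facet_of P"
  shows "0 < lorentz (nrm F) (nrm F)"
proof -
  obtain v where "v \<in> F" using assms by (auto simp: facet_of_def)
  then show ?thesis
    using lorentz_pos_of_orthogonal_lift[of v "nrm F"] mem_facet_iff[OF assms]
      facet_normal_nonzero[OF assms] subset_ball by blast
qed

text \<open>Otherwise the segment from an interior point to \<open>y\<close> would cross a facet
  before \<open>y\<close>, but the form of that facet is negative at the start and nonpositive at
  \<open>y\<close>.\<close>

lemma mem_polytopeI:
  assumes "\<And>F. F facet_of P \<Longrightarrow> lorentz (nrm F) (lift y) \<le> 0"
  shows "y \<in> P"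
proof (rule ccontr)
  assume y: "y \<notin> P"
  obtain c where c: "c \<in> interior P" using interior by auto
  obtain K t where K: "K facet_of P" "0 < t" "t < 1" "c + t *\<^sub>R (y - c) \<in> K"
    using polytope_exit_facet[OF polytope, of c y] c y by (auto simp: rel_interior affine_hull)
  show False
    using lorentz_lift_segment_less[OF lorentz_interior_less[OF K(1) c] assms[OF K(1)] K(2,3)]
      mem_facet_iff[OF K(1)] K(4) by simp
qed

text \<open>Facets missing \<open>x\<close> hold strictly there and survive a small step by
  continuity; there are finitely many facets, so one step size serves them all.\<close>

lemma feasible_direction:
  assumes x: "x \<in> P" and d: "\<And>F. F facet_of P \<Longrightarrow> x \<in> F \<Longrightarrow> fst (nrm F) \<bullet> d \<le> 0"
  obtains e where "0 < e" "x + e *\<^sub>R d \<in> P"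
proof -
  have ev: "\<forall>\<^sub>F e in at_right 0. lorentz (nrm F) (lift (x + e *\<^sub>R d)) \<le> 0" if F: "F facet_of P" for F
  proof (cases "x \<in> F")
    case True
    then have "lorentz (nrm F) (lift x) = 0" using mem_facet_iff[OF F] by blast
    then have "lorentz (nrm F) (lift (x + e *\<^sub>R d)) \<le> 0" if "0 < e" for e
      using d[OF F True] that by (simp add: lorentz_lift inner_add_right mult_nonneg_nonpos)
    then show ?thesis
      using eventually_at_right_less by (rule eventually_mono[rotated])
  next
    case False
    have "((\<lambda>e. fst (nrm F) \<bullet> (x + e *\<^sub>R d) - snd (nrm F)) \<longlongrightarrow>
        fst (nrm F) \<bullet> (x + 0 *\<^sub>R d) - snd (nrm F)) (at_right 0)"
      by (intro tendsto_intros)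
    then have "\<forall>\<^sub>F e in at_right 0. fst (nrm F) \<bullet> (x + e *\<^sub>R d) - snd (nrm F) < 0"
      by (rule order_tendstoD) (use lorentz_facet_less[OF F x False] in \<open>simp add: lorentz_lift\<close>)
    then show ?thesis
      by (rule eventually_mono) (simp add: lorentz_lift)
  qed
  have "\<forall>\<^sub>F e in at_right 0. \<forall>F\<in>{F. F facet_of P}. lorentz (nrm F) (lift (x + e *\<^sub>R d)) \<le> 0"
    by (rule eventually_ball_finite[OF finite_facets]) (use ev in auto)
  then have "\<forall>\<^sub>F e in at_right 0. 0 < e \<and> (\<forall>F\<in>{F. F facet_of P}. lorentz (nrm F) (lift (x + e *\<^sub>R d)) \<le> 0)"
    using eventually_at_right_less[of "0::real"] by (rule eventually_conj[rotated])
  then obtain e where "0 < e" "\<forall>F\<in>{F. F facet_of P}. lorentz (nrm F) (lift (x + e *\<^sub>R d)) \<le> 0"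
    using eventually_happens'[OF trivial_limit_at_right_real] by blast
  then show ?thesis
    using that mem_polytopeI by blast
qed

text \<open>Applying \<open>cos\<close> undoes \<open>arccos\<close> only on arguments between -1
  and 1. The common point \<open>v\<close> ensures this range, since both normals are orthogonal to
  \<open>lift v\<close>.\<close>

lemma lorentz_eq_0_of_right_angle:
  assumes F: "F facet_of P" "v \<in> F" and G: "G facet_of P" "v \<in> G"
    and angle: "dihedral_angle P F G = pi / 2"
  shows "lorentz (nrm F) (nrm G) = 0"
proof -
  let ?s = "sqrt (lorentz (nrm F) (nrm F)) * sqrt (lorentz (nrm G) (nrm G))"
  have pos: "0 < ?s"
    using facet_normal_spacelike F G by simp
  have "v \<in> ball 0 1"
    using F mem_facet_iff subset_ball by blast
  then have "(lorentz (nrm F) (nrm G))\<^sup>2 \<le> lorentz (nrm F) (nrm F) * lorentz (nrm G) (nrm G)"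
    using mem_facet_iff F G by (intro lorentz_cauchy_schwarz[of v]) blast+
  then have "sqrt ((lorentz (nrm F) (nrm G))\<^sup>2) \<le> sqrt (lorentz (nrm F) (nrm F) * lorentz (nrm G) (nrm G))"
    by (rule real_sqrt_le_mono)
  then have "\<bar>lorentz (nrm F) (nrm G)\<bar> \<le> ?s"
    by (simp add: real_sqrt_mult)
  then have "\<bar>- lorentz (nrm F) (nrm G) / ?s\<bar> \<le> 1"
    using pos abs_of_pos[OF pos] by (simp only: abs_divide abs_minus_cancel divide_le_eq_1_pos)
  then have "cos (dihedral_angle P F G) = - lorentz (nrm F) (nrm G) / ?s"
    unfolding dihedral_angle_def by (rule cos_arccos_abs)
  then show ?thesis
    using angle pos by (simp only: cos_pi_half) (metis divide_eq_0_iff less_irrefl neg_equal_0_iff_equal)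
qed

section \<open>Edges and the facets containing them\<close>

lemma edge_segment:
  assumes "E edge_of P"
  obtains v w where "v \<noteq> w" "E = closed_segment v w"
proof -
  have face: "E face_of P" and d: "aff_dim E = 1"
    using assms by (auto simp: edge_of_def)
  have "E \<noteq> {}" using d by auto
  moreover have "compact E" "convex E"
    using face polytope face_of_imp_compact face_of_imp_convex convex polytope_imp_compact by blast+
  moreover have "collinear E" using d by (simp add: collinear_aff_dim)
  ultimately obtain v w where E: "E = closed_segment v w"
    using compact_convex_collinear_segment by blast
  then have "v \<noteq> w" using d by auto
  then show ?thesis using that E by blast
qed

lemma edge_facets_iff:
  assumes "E = closed_segment v w"
  shows "H \<in> edge_facets P E \<longleftrightarrow> H facet_of P \<and> v \<in> H \<and> w \<in> H"
proof -
  have "H facet_of P \<Longrightarrow> convex H"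
    using face_of_imp_convex facet_of_imp_face_of by blast
  then show ?thesis
    unfolding edge_facets_def assms
    using closed_segment_subset ends_in_segment[of v w] by blast
qed

text \<open>The edge is the intersection of its facets. A direction tangent to all of them can be
  followed from the midpoint without leaving \<open>P\<close>, hence without leaving
  \<open>E\<close>, so it is parallel to \<open>w - v\<close>.\<close>

lemma orthogonal_to_edge_facets:
  assumes edge: "E edge_of P" and E: "E = closed_segment v w"
    and orth: "\<And>H. H \<in> edge_facets P E \<Longrightarrow> lorentz (nrm H) r = 0"
  obtains a b where "r = a *\<^sub>R lift v + b *\<^sub>R lift w"
proof -
  \<comment> \<open>Subtracting \<open>snd r *\<^sub>R lift v\<close> from \<open>r\<close> clears
    the last coordinate and leaves \<open>(y, 0)\<close>.\<close>
  define y where "y = fst r - snd r *\<^sub>R v"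
  define m where "m = midpoint v w"
  have face: "E face_of P" and d: "aff_dim E = 1"
    using edge by (auto simp: edge_of_def)
  have vw: "v \<in> P" "w \<in> P"
    using face face_of_imp_subset E by auto
  have ne: "v \<noteq> w" using d E by auto
  have m: "m \<in> open_segment v w"
    using ne by (simp add: m_def)
  have mP: "m \<in> P"
    using m vw convex by (meson closed_segment_subset open_closed_segment subsetD)
  have "fst (nrm H) \<bullet> y \<le> 0" if H: "H facet_of P" "m \<in> H" for H
  proof -
    \<comment> \<open>A face meeting the open segment contains both of its endpoints.\<close>
    have "v \<in> H \<and> w \<in> H"
      using face_ofD[OF facet_of_imp_face_of[OF H(1)] m vw H(2)] .
    then have HE: "H \<in> edge_facets P E"
      using H edge_facets_iff[OF E] by blast
    have "fst (nrm H) \<bullet> v = snd (nrm H)"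
      using \<open>v \<in> H \<and> w \<in> H\<close> mem_facet_iff[OF H(1)] by (simp add: lorentz_lift)
    then show ?thesis
      using orth[OF HE] by (simp add: y_def lorentz_def inner_diff_right)
  qed
  then obtain e where e: "0 < e" "m + e *\<^sub>R y \<in> P"
    using feasible_direction[OF mP] by blast
  have "m + e *\<^sub>R y \<in> H" if HE: "H \<in> edge_facets P E" for H
  proof -
    have H: "H facet_of P" "v \<in> H" "w \<in> H"
      using HE edge_facets_iff[OF E] by blast+
    have 1: "fst (nrm H) \<bullet> v = snd (nrm H)" "fst (nrm H) \<bullet> w = snd (nrm H)"
      using H mem_facet_iff[OF H(1)] by (simp_all add: lorentz_lift)
    then have "fst (nrm H) \<bullet> y = 0"
      using orth[OF HE] by (simp add: y_def lorentz_def inner_diff_right)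
    then show ?thesis
      using e 1 mem_facet_iff[OF H(1)] by (simp add: lorentz_lift inner_add_right m_def midpoint_def)
  qed
  then have "m + e *\<^sub>R y \<in> \<Inter> (edge_facets P E)" by blast
  moreover have "E = \<Inter> (edge_facets P E)"
    unfolding edge_facets_def
  proof (rule face_of_polyhedron[OF polyhedron face])
    show "E \<noteq> {}" using d by auto
    show "E \<noteq> P" using d aff_dim dim_ge_3 by auto
  qed
  ultimately have "m + e *\<^sub>R y \<in> closed_segment v w"
    using E by metis
  then obtain u where "m + e *\<^sub>R y = (1 - u) *\<^sub>R v + u *\<^sub>R w"
    by (auto simp: in_segment)
  then have "e *\<^sub>R y = (1 - u) *\<^sub>R v + u *\<^sub>R w - (1/2) *\<^sub>R (v + w)"
    by (simp add: m_def midpoint_def algebra_simps)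
  also have "\<dots> = (1 - u - 1/2) *\<^sub>R v + (u - 1/2) *\<^sub>R w"
    unfolding scaleR_diff_left scaleR_add_right by simp
  also have "1 - u - 1/2 = - (u - 1/2)" by simp
  also have "- (u - 1/2) *\<^sub>R v = - ((u - 1/2) *\<^sub>R v)" by (rule scaleR_minus_left)
  finally have "e *\<^sub>R y = (u - 1/2) *\<^sub>R (w - v)"
    by (simp add: scaleR_diff_right)
  then have "(1/e) *\<^sub>R (e *\<^sub>R y) = (1/e) *\<^sub>R ((u - 1/2) *\<^sub>R (w - v))" by simp
  then have y: "y = ((u - 1/2)/e) *\<^sub>R (w - v)"
    using e by simp
  define k where "k = (u - 1/2)/e"
  have "r = (snd r - k) *\<^sub>R lift v + k *\<^sub>R lift w"
    using y unfolding y_def k_def[symmetric]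
    by (simp add: lift_def prod_eq_iff algebra_simps)
  then show ?thesis using that by blast
qed

lemma finite_edge_facets: "finite (edge_facets P E)"
  using finite_facets by (rule rev_finite_subset) (auto simp: edge_facets_def)

text \<open>The common orthogonal complement of the spatial parts of the normals lies in the line
  spanned by \<open>w - v\<close>, so these parts span at least \<open>n - 1\<close>
  dimensions.\<close>

lemma card_edge_facets_ge:
  assumes edge: "E edge_of P"
  shows "CARD('n) \<le> card (edge_facets P E) + 1"
proof -
  obtain v w where E: "E = closed_segment v w"
    using edge edge_segment by metis
  define A where "A = (\<lambda>H. fst (nrm H)) ` edge_facets P E"
  have "{y \<in> UNIV. \<forall>x\<in>span A. orthogonal x y} \<subseteq> span {w - v}"
  proof
    fix y assume "y \<in> {y \<in> UNIV. \<forall>x\<in>span A. orthogonal x y}"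
    then have "\<And>H. H \<in> edge_facets P E \<Longrightarrow> lorentz (nrm H) (y, 0) = 0"
      by (auto simp: A_def lorentz_def orthogonal_def intro: span_base)
    then obtain a b where "(y, 0) = a *\<^sub>R lift v + b *\<^sub>R lift w"
      using orthogonal_to_edge_facets[OF edge E] by blast
    then have "y = a *\<^sub>R v + b *\<^sub>R w" "a = - b"
      by (auto simp: lift_def prod_eq_iff)
    then have "y = b *\<^sub>R (w - v)" by (simp add: algebra_simps)
    then show "y \<in> span {w - v}"
      by (simp add: span_base span_scale)
  qed
  then have "dim {y \<in> UNIV. \<forall>x\<in>span A. orthogonal x y} \<le> card {w - v}"
    by (rule dim_le_card) simp
  moreover have "dim {y \<in> UNIV. \<forall>x\<in>span A. orthogonal x y} + dim (span A) = CARD('n)"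
    using dim_subspace_orthogonal_to_vectors[of "span A" UNIV] by simp
  moreover have "dim (span A) \<le> card A"
    using finite_edge_facets by (simp add: dim_le_card' A_def)
  moreover have "card A \<le> card (edge_facets P E)"
    using finite_edge_facets by (simp add: A_def card_image_le)
  ultimately show ?thesis by simp
qed

end

section \<open>The width of a right-angled outermost ridge\<close>

text \<open>Here \<open>t\<close> is the cosh of the length of the edge. With
  \<open>M = max x y\<close> the hypotheses combine to
  \<open>N M^2 (t^2 - 1) <= K < x^2 + y^2 + 2 x y t <= 2 M^2 (t + 1)\<close>, and cancelling
  \<open>M^2 (t + 1)\<close> leaves \<open>N (t - 1) < 2\<close>.\<close>

lemma width_bound_arithmetic:
  fixes a b q1 q2 D Q K N :: real
  assumes pos: "0 < a" "0 < b" "0 < q1" "0 < q2" "0 < Q" "0 < N"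
    and D: "0 < D" "q1 * q2 \<le> D\<^sup>2"
    and total: "Q + K = a\<^sup>2 * q1 + b\<^sup>2 * q2 + 2 * a * b * D"
    and K1: "N * (b\<^sup>2 * ((D\<^sup>2 - q1 * q2) / q1)) \<le> K"
    and K2: "N * (a\<^sup>2 * ((D\<^sup>2 - q1 * q2) / q2)) \<le> K"
  shows "D / sqrt (q1 * q2) < (N + 2) / N"
proof -
  define t x y where "t = D / sqrt (q1 * q2)" and "x = a * sqrt q1" and "y = b * sqrt q2"
  have xy: "0 < x" "0 < y" using pos by (simp_all add: x_def y_def)
  have t0: "0 < t" using pos D by (simp add: t_def)
  have t2: "t\<^sup>2 = D\<^sup>2 / (q1 * q2)"
    using pos by (simp add: t_def power_divide)
  then have "1 \<le> t\<^sup>2" using D pos by simp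
  then have t1: "1 \<le> t" using t0 abs_le_square_iff[of 1 t] by simp
  have sq: "x\<^sup>2 = a\<^sup>2 * q1" "y\<^sup>2 = b\<^sup>2 * q2"
    using pos by (simp_all add: x_def y_def power_mult_distrib)
  have D_eq: "D = t * (sqrt q1 * sqrt q2)"
    using pos by (simp add: t_def real_sqrt_mult)
  have xyt: "a * b * D = x * y * t"
    unfolding D_eq x_def y_def by (simp add: algebra_simps)
  have k: "b\<^sup>2 * ((D\<^sup>2 - q1 * q2) / q1) = y\<^sup>2 * (t\<^sup>2 - 1)"
      "a\<^sup>2 * ((D\<^sup>2 - q1 * q2) / q2) = x\<^sup>2 * (t\<^sup>2 - 1)"
    unfolding t2 sq using pos by (simp_all add: field_simps)
  define M where "M = max x y"
  have M: "0 < M" "x \<le> M" "y \<le> M" using xy by (auto simp: M_def)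
  have "N * (M\<^sup>2 * (t\<^sup>2 - 1)) \<le> K"
    using K1 K2 unfolding k M_def by (auto simp: max_def)
  \<comment> \<open>The strict inequality of the theorem originates here, from
    \<open>Q > 0\<close>.\<close>
  also have "K < x\<^sup>2 + y\<^sup>2 + 2 * (x * y) * t"
    using total pos(5) sq xyt by (simp add: algebra_simps)
  also have "\<dots> \<le> M\<^sup>2 + M\<^sup>2 + 2 * (M * M) * t"
    using M xy t0 by (intro add_mono power_mono mult_mono) auto
  also have "\<dots> = M\<^sup>2 * (2 * (t + 1))"
    by (simp add: power2_eq_square algebra_simps)
  finally have "M\<^sup>2 * (N * (t\<^sup>2 - 1)) < M\<^sup>2 * (2 * (t + 1))"
    by (simp add: algebra_simps)
  then have "N * (t\<^sup>2 - 1) < 2 * (t + 1)"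
    using M by simp
  then have "(t + 1) * (N * (t - 1)) < (t + 1) * 2"
    by (simp add: power2_eq_square algebra_simps)
  then have "N * (t - 1) < 2"
    using t0 by (subst (asm) mult_less_cancel_left_pos) auto
  then show ?thesis
    unfolding t_def[symmetric] using pos by (simp add: field_simps)
qed

context hyp_polytope
begin

lemma edge_facet_facet: "H \<in> edge_facets P E \<Longrightarrow> H facet_of P"
  by (simp add: edge_facets_def)

lemma framing_facet_facet: "F \<in> framing_facets P E \<Longrightarrow> F facet_of P"
  by (simp add: framing_facets_def)

lemma framing_facet_not_edge: "F \<in> framing_facets P E \<Longrightarrow> F \<notin> edge_facets P E"
  by (simp add: framing_facets_def edge_facets_def)

text \<open>A facet containing both endpoints contains the whole edge, so a framing facet contains
  exactly one of them.\<close>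

lemma framing_facets_iff:
  assumes "E = closed_segment v w"
  shows "F \<in> framing_facets P E \<longleftrightarrow> F facet_of P \<and> (v \<in> F) \<noteq> (w \<in> F)"
proof -
  have "F \<in> framing_facets P E \<longleftrightarrow> F facet_of P \<and> F \<notin> edge_facets P E \<and> (v \<in> F \<or> w \<in> F)"
    unfolding framing_facets_def edge_facets_def assms extreme_point_of_segment by blast
  then show ?thesis
    unfolding edge_facets_iff[OF assms] by blast
qed

lemma right_angled_ridge_orthogonal_edge:
  assumes edge: "E edge_of P" and ra: "right_angled_ridge P E"
    and H: "H \<in> edge_facets P E" and F: "F \<in> edge_facets P E \<union> framing_facets P E" and "H \<noteq> F"
  shows "lorentz (nrm H) (nrm F) = 0"
proof -
  obtain v w where E: "E = closed_segment v w"
    using edge edge_segment by metis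
  have "F facet_of P" "H facet_of P" "v \<in> F \<or> w \<in> F" "v \<in> H" "w \<in> H"
    using H F edge_facets_iff[OF E] framing_facets_iff[OF E] by blast+
  moreover have "dihedral_angle P H F = pi / 2"
    using ra H F \<open>H \<noteq> F\<close> framing_facet_not_edge unfolding right_angled_ridge_def by blast
  ultimately show ?thesis
    using lorentz_eq_0_of_right_angle by blast
qed

end

section \<open>Geometry at an endpoint of an edge with right-angled ridge\<close>

locale right_angled_edge = hyp_polytope P for P :: "(real^'n) set" +
  fixes E :: "(real^'n) set" and v w :: "real^'n"
  assumes edge: "E edge_of P" and segment: "E = closed_segment v w"
    and right_angled: "right_angled_ridge P E"
begin

lemma endpoints: "v \<in> P" "w \<in> P" "v \<in> ball 0 1" "w \<in> ball 0 1" "v \<noteq> w"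
proof -
  have "E face_of P" and d: "aff_dim E = 1"
    using edge by (auto simp: edge_of_def)
  then show "v \<in> P" "w \<in> P"
    using face_of_imp_subset segment by auto
  then show "v \<in> ball 0 1" "w \<in> ball 0 1"
    using subset_ball by auto
  show "v \<noteq> w" using d segment by auto
qed

text \<open>Facts shown at \<open>v\<close> are transferred to \<open>w\<close> by this
  symmetry.\<close>

lemma reverse: "right_angled_edge P E w v"
  by unfold_locales (use edge segment right_angled closed_segment_commute in auto)

lemma orthogonal_edge_facets: "lorentz_orthogonal (nrm ` edge_facets P E)"
  unfolding lorentz_orthogonal_def
  using finite_edge_facets facet_normal_spacelike edge_facet_facet
    right_angled_ridge_orthogonal_edge[OF edge right_angled] by blast

lemma orthogonal_insert_framing:
  assumes "F \<in> framing_facets P E"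
  shows "lorentz_orthogonal (nrm ` insert F (edge_facets P E))"
proof -
  have "lorentz (nrm H) (nrm F) = 0 \<and> lorentz (nrm F) (nrm H) = 0" if "H \<in> edge_facets P E" for H
    using right_angled_ridge_orthogonal_edge[OF edge right_angled that, of F]
      assms that framing_facet_not_edge lorentz_commute by (metis UnI2)
  then show ?thesis
    using orthogonal_edge_facets facet_normal_spacelike[OF framing_facet_facet[OF assms]]
    unfolding lorentz_orthogonal_def by auto
qed

text \<open>Orthogonality to the edge facets puts the normal into the plane of \<open>lift v\<close>
  and \<open>lift w\<close>, and orthogonality to \<open>lift v\<close> leaves one line in it: that
  of the component of \<open>lift w\<close> orthogonal to \<open>lift v\<close>.\<close>

lemma framing_normal:
  assumes F: "F \<in> framing_facets P E" "v \<in> F"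
  obtains b where "nrm F = b *\<^sub>R (lift w - ((1 - v \<bullet> w) / (1 - (norm v)\<^sup>2)) *\<^sub>R lift v)" "b \<noteq> 0"
proof -
  have Ff: "F facet_of P" using F framing_facet_facet by blast
  have "lorentz (nrm H) (nrm F) = 0" if "H \<in> edge_facets P E" for H
    using right_angled_ridge_orthogonal_edge[OF edge right_angled that, of F]
      F that framing_facet_not_edge by blast
  then obtain a b where ab: "nrm F = a *\<^sub>R lift v + b *\<^sub>R lift w"
    using orthogonal_to_edge_facets[OF edge segment] by blast
  have q: "0 < 1 - (norm v)\<^sup>2" using endpoints one_minus_norm_sq_pos by blast
  have "lorentz (nrm F) (lift v) = 0"
    using F mem_facet_iff[OF Ff] by blast
  then have "a * (1 - (norm v)\<^sup>2) + b * (1 - v \<bullet> w) = 0"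
    unfolding ab by (simp add: lorentz_linear lorentz_lift_lift dot_square_norm inner_commute algebra_simps)
  then have a: "a = - (b * ((1 - v \<bullet> w) / (1 - (norm v)\<^sup>2)))"
    using q by (simp add: field_simps)
  have eq: "nrm F = b *\<^sub>R (lift w - ((1 - v \<bullet> w) / (1 - (norm v)\<^sup>2)) *\<^sub>R lift v)"
    unfolding ab a by (simp add: algebra_simps)
  moreover have "b \<noteq> 0"
    using eq facet_normal_nonzero[OF Ff] by (metis scale_zero_left)
  ultimately show ?thesis using that by blast
qed

text \<open>Both normals are nonzero multiples of the same vector, so they vanish at the same points
  of \<open>P\<close>.\<close>

lemma framing_facet_unique:
  assumes "F \<in> framing_facets P E" "v \<in> F" "G \<in> framing_facets P E" "v \<in> G"
  shows "F = G"
proof -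
  let ?f = "lift w - ((1 - v \<bullet> w) / (1 - (norm v)\<^sup>2)) *\<^sub>R lift v"
  obtain b b' where b: "nrm F = b *\<^sub>R ?f" "b \<noteq> 0" "nrm G = b' *\<^sub>R ?f" "b' \<noteq> 0"
    using framing_normal assms by metis
  have "x \<in> F \<longleftrightarrow> x \<in> G" for x
    using mem_facet_iff[of F x] mem_facet_iff[of G x] framing_facet_facet assms(1,3) b(2,4)
    unfolding b(1,3) lorentz_scaleR_left by simp
  then show ?thesis by blast
qed

text \<open>The normal is a multiple of the orthogonal component \<open>f\<close> of
  \<open>lift w\<close>, so the squared coordinate is \<open>lorentz f f\<close>, a quotient of Gram
  determinants.\<close>

lemma coord_sq_framing:
  assumes "F \<in> framing_facets P E" "v \<in> F"
  shows "coord_sq (lift w) (nrm F)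
    = ((1 - v \<bullet> w)\<^sup>2 - (1 - (norm v)\<^sup>2) * (1 - (norm w)\<^sup>2)) / (1 - (norm v)\<^sup>2)"
proof -
  define D q1 q2 where "D = 1 - v \<bullet> w" and "q1 = 1 - (norm v)\<^sup>2" and "q2 = 1 - (norm w)\<^sup>2"
  define f where "f = lift w - (D / q1) *\<^sub>R lift v"
  obtain b where b: "nrm F = b *\<^sub>R f" "b \<noteq> 0"
    using framing_normal[OF assms] unfolding f_def D_def q1_def by metis
  have q1: "0 < q1" using endpoints one_minus_norm_sq_pos by (simp add: q1_def)
  have prods: "lorentz (lift v) (lift v) = - q1" "lorentz (lift w) (lift w) = - q2"
      "lorentz (lift v) (lift w) = - D" "lorentz (lift w) (lift v) = - D"
    by (simp_all add: lorentz_lift_lift q1_def q2_def D_def dot_square_norm inner_commute)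
  have wf: "lorentz (lift w) f = (D\<^sup>2 - q1 * q2) / q1"
    unfolding f_def lorentz_linear prods using q1 by (simp add: field_simps power2_eq_square)
  have "lorentz (lift v) f = 0"
    unfolding f_def lorentz_linear prods using q1 by simp
  \<comment> \<open>Only the left argument \<open>f\<close> is expanded, so that its multiple of
    \<open>lift v\<close> vanishes against the right one.\<close>
  then have ff: "lorentz f f = lorentz (lift w) f"
    unfolding f_def[THEN arg_cong[where f="\<lambda>u. lorentz u f"]] lorentz_diff_left lorentz_scaleR_left by simp
  have "lorentz f f \<noteq> 0"
    using facet_normal_spacelike[OF framing_facet_facet[OF assms(1)]] b
    by (auto simp: lorentz_linear)
  then have "coord_sq (lift w) (nrm F) = lorentz (lift w) f"
    using b(2) unfolding coord_sq_def b(1) ff[symmetric] lorentz_linear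
    by (simp add: ff power2_eq_square)
  then show ?thesis
    unfolding wf D_def q1_def q2_def .
qed

text \<open>Only \<open>F\<close> and the edge facets pass through \<open>v\<close>. Intersecting
  all of them except \<open>H\<close> gives a face, which contains a step from \<open>v\<close> in a
  direction leaving \<open>H\<close> and has no further dimension.\<close>

lemma neighbour_edge:
  assumes F: "F \<in> framing_facets P E" "v \<in> F" and H: "H \<in> edge_facets P E"
  obtains E' where "E' edge_of P" "\<And>G. G \<in> insert F (edge_facets P E - {H}) \<Longrightarrow> E' \<subseteq> G"
proof -
  let ?S = "insert F (edge_facets P E - {H})"
  define E' where "E' = \<Inter> ?S"
  have Ff: "F facet_of P" and Hf: "H facet_of P"
    using F H framing_facet_facet edge_facet_facet by blast+
  have wF: "w \<notin> F" using F framing_facets_iff[OF segment] by blast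
  have FH: "F \<noteq> H" using F H framing_facet_not_edge by blast
  have Sf: "G facet_of P" "v \<in> G" if "G \<in> ?S" for G
    using that F Ff edge_facets_iff[OF segment] by blast+
  have at_v: "G \<in> ?S \<or> G = H" if "G facet_of P" "v \<in> G" for G
    using that framing_facet_unique[OF F, of G] framing_facets_iff[OF segment] edge_facets_iff[OF segment]
    by blast
  \<comment> \<open>The normal of \<open>H\<close>, rewritten as a direction at \<open>v\<close>, points along the remaining facets by orthogonality.\<close>
  define d where "d = - (fst (nrm H) - snd (nrm H) *\<^sub>R v)"
  have d_eq: "fst (nrm G) \<bullet> d = - lorentz (nrm G) (nrm H)" if "G facet_of P" "v \<in> G" for G
  proof -
    have "fst (nrm G) \<bullet> v = snd (nrm G)"
      using that mem_facet_iff by (simp add: lorentz_lift)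
    then show ?thesis by (simp add: d_def lorentz_def inner_diff_right)
  qed
  have dS: "fst (nrm G) \<bullet> d = 0" if "G \<in> ?S" for G
  proof -
    have "lorentz (nrm H) (nrm G) = 0"
      using right_angled_ridge_orthogonal_edge[OF edge right_angled H, of G] that F FH by blast
    then show ?thesis
      using d_eq Sf[OF that] by (simp add: lorentz_commute)
  qed
  have vH: "v \<in> H" using H edge_facets_iff[OF segment] by blast
  have dH: "fst (nrm H) \<bullet> d < 0"
    using d_eq[OF Hf vH] facet_normal_spacelike[OF Hf] by simp
  have "fst (nrm G) \<bullet> d \<le> 0" if "G facet_of P" "v \<in> G" for G
    using at_v[OF that] dS[of G] dH by (metis order_refl less_imp_le)
  then obtain e where e: "0 < e" "v + e *\<^sub>R d \<in> P"
    using feasible_direction[OF endpoints(1)] by blast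
  let ?x = "v + e *\<^sub>R d"
  have "?x \<in> G" if "G \<in> ?S" for G
    using e dS[OF that] mem_facet_iff[of G] Sf[OF that]
    by (simp add: lorentz_lift inner_add_right)
  then have in_E': "{v, ?x} \<subseteq> E'"
    using Sf by (auto simp: E'_def)
  have d0: "d \<noteq> 0" using dH by auto
  have "E' \<subseteq> affine hull {v, ?x}"
  proof
    fix y assume y: "y \<in> E'"
    \<comment> \<open>Removing the multiple of \<open>d\<close> with the same component along
      \<open>H\<close> makes \<open>z\<close> orthogonal to all edge normals, hence parallel to
      \<open>w - v\<close>; then \<open>F\<close>, which misses \<open>w\<close>, forces
      \<open>z = 0\<close>.\<close>
    define k where "k = fst (nrm H) \<bullet> (y - v) / (fst (nrm H) \<bullet> d)"
    define z where "z = (y - v) - k *\<^sub>R d"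
    have zS: "fst (nrm G) \<bullet> z = 0" if "G \<in> ?S" for G
    proof -
      have "y \<in> G" using y that by (auto simp: E'_def)
      then have "fst (nrm G) \<bullet> (y - v) = 0"
        using Sf[OF that] mem_facet_iff[of G] by (simp add: lorentz_lift inner_diff_right)
      then show ?thesis by (simp add: z_def inner_diff_right dS[OF that])
    qed
    moreover have "fst (nrm H) \<bullet> z = 0"
      using dH by (simp add: z_def k_def inner_diff_right)
    ultimately have "lorentz (nrm G) (z, 0) = 0" if "G \<in> edge_facets P E" for G
      using that by (cases "G = H") (auto simp: lorentz_def)
    then obtain a b where "(z, 0) = a *\<^sub>R lift v + b *\<^sub>R lift w"
      using orthogonal_to_edge_facets[OF edge segment] by blast
    then have "z = a *\<^sub>R v + b *\<^sub>R w" "a = - b"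
      by (auto simp: lift_def prod_eq_iff)
    then have z: "z = b *\<^sub>R (w - v)" by (simp add: algebra_simps)
    have "b * lorentz (nrm F) (lift w) = fst (nrm F) \<bullet> z"
      using F mem_facet_iff[OF Ff] unfolding z by (simp add: lorentz_lift inner_diff_right)
    then have "b = 0"
      using zS[of F] lorentz_facet_less[OF Ff endpoints(2) wF] by simp
    then have "y = (1 - k / e) *\<^sub>R v + (k / e) *\<^sub>R ?x"
      using z e by (simp add: z_def algebra_simps)
    then show "y \<in> affine hull {v, ?x}"
      unfolding affine_hull_2 by (intro CollectI exI[of _ "1 - k / e"] exI[of _ "k / e"]) auto
  qed
  then have "aff_dim E' \<le> aff_dim {v, ?x}"
    by (metis aff_dim_affine_hull aff_dim_subset)
  moreover have "aff_dim {v, ?x} \<le> aff_dim E'"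
    using in_E' by (rule aff_dim_subset)
  moreover have "aff_dim {v, ?x} = 1"
    using e d0 by simp
  moreover have "E' face_of P"
    unfolding E'_def by (rule face_of_Inter) (simp, rule facet_of_imp_face_of[OF Sf(1)])
  ultimately have "E' edge_of P"
    by (simp add: edge_of_def)
  then show ?thesis
    using that[of E'] by (auto simp: E'_def)
qed

end

section \<open>Projecting an interior point to the edge\<close>

locale right_angled_framed_edge = right_angled_edge P E v w
  for P :: "(real^'n) set" and E :: "(real^'n) set" and v w :: "real^'n" +
  fixes F G :: "(real^'n) set" and c :: "real^'n"
  assumes F: "F \<in> framing_facets P E" "v \<in> F" and G: "G \<in> framing_facets P E" "w \<in> G"
    and c: "c \<in> interior P"
begin

lemma reverse_framed: "right_angled_framed_edge P E w v G F c"
  using reverse F G c by (simp add: right_angled_framed_edge_def right_angled_framed_edge_axioms_def)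

abbreviation "res \<equiv> residual (lift c) (nrm ` edge_facets P E)"

text \<open>The normal of \<open>F\<close> is orthogonal to the edge normals and to
  \<open>lift v\<close>, so pairing it with the residual isolates \<open>b\<close>. The sign of
  \<open>b\<close> is positive because \<open>c\<close> and \<open>w\<close> both lie strictly
  inside \<open>F\<close>.\<close>

lemma residual_coefficient:
  assumes "res = a *\<^sub>R lift v + b *\<^sub>R lift w"
  shows "0 < b" "coord_sq (lift c) (nrm F) = b\<^sup>2 * coord_sq (lift w) (nrm F)"
proof -
  have Ff: "F facet_of P" using F framing_facet_facet by blast
  have "lorentz res (nrm F) = lorentz (lift c) (nrm F)"
  proof (rule lorentz_residual_orthogonal)
    fix u assume "u \<in> nrm ` edge_facets P E"
    then show "lorentz u (nrm F) = 0"
      using right_angled_ridge_orthogonal_edge[OF edge right_angled] F framing_facet_not_edge by blast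
  qed
  moreover have "lorentz (lift v) (nrm F) = 0"
    using F mem_facet_iff[OF Ff] lorentz_commute by metis
  ultimately have eq: "lorentz (lift c) (nrm F) = b * lorentz (lift w) (nrm F)"
    unfolding assms by (simp add: lorentz_linear)
  have "w \<notin> F" using F framing_facets_iff[OF segment] by blast
  then have "lorentz (lift w) (nrm F) < 0" "lorentz (lift c) (nrm F) < 0"
    using lorentz_facet_less[OF Ff endpoints(2)] lorentz_interior_less[OF Ff c]
    by (simp_all add: lorentz_commute)
  then show "0 < b"
    unfolding eq by (simp add: mult_less_0_iff)
  show "coord_sq (lift c) (nrm F) = b\<^sup>2 * coord_sq (lift w) (nrm F)"
    by (simp add: coord_sq_def eq power_mult_distrib)
qed

text \<open>Geometrically, the foot of the perpendicular from \<open>c\<close> to the line of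
  \<open>E\<close> lies strictly between \<open>v\<close> and \<open>w\<close>; positivity of
  \<open>a\<close> comes from the reversed edge.\<close>

lemma residual_eq:
  obtains a b where "res = a *\<^sub>R lift v + b *\<^sub>R lift w" "0 < a" "0 < b"
proof -
  have "lorentz (nrm H) res = 0" if "H \<in> edge_facets P E" for H
    using lorentz_residual_in[OF orthogonal_edge_facets] that lorentz_commute by (metis imageI)
  then obtain a b where ab: "res = a *\<^sub>R lift v + b *\<^sub>R lift w"
    using orthogonal_to_edge_facets[OF edge segment] by blast
  interpret rev: right_angled_framed_edge P E w v G F c by (rule reverse_framed)
  show ?thesis
    using that[OF ab] residual_coefficient(1)[OF ab] rev.residual_coefficient(1)[of b a] ab
    by (simp add: add.commute)
qed

lemma c_in_ball: "c \<in> ball 0 1"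
  using c interior_subset subset_ball by blast

lemma hsetdist_edge_le:
  "hsetdist {c} E \<le> arcosh (sqrt (1 + (\<Sum>u\<in>nrm ` edge_facets P E. coord_sq (lift c) u) / (1 - (norm c)\<^sup>2)))"
proof -
  obtain a b where ab: "res = a *\<^sub>R lift v + b *\<^sub>R lift w" "0 < a" "0 < b"
    by (rule residual_eq)
  \<comment> \<open>The residual rescaled to have last coordinate 1.\<close>
  define p where "p = (a / (a + b)) *\<^sub>R v + (b / (a + b)) *\<^sub>R w"
  have "p = (1 - b / (a + b)) *\<^sub>R v + (b / (a + b)) *\<^sub>R w"
    using ab by (simp add: p_def field_simps)
  then have pE: "p \<in> E"
    unfolding segment in_segment using ab by (intro exI[of _ "b / (a + b)"]) auto
  have EB: "E \<subseteq> ball 0 1"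
    using edge edge_of_imp_subset subset_ball by blast
  have "a *\<^sub>R lift v + b *\<^sub>R lift w = (a + b) *\<^sub>R lift p"
    using ab(2,3) unfolding p_def lift_def by (simp add: scaleR_add_right)
  then have "res = (a + b) *\<^sub>R lift p"
    unfolding ab(1) .
  then have "hdist c p = arcosh (sqrt (1 + (\<Sum>u\<in>nrm ` edge_facets P E. coord_sq (lift c) u) / (1 - (norm c)\<^sup>2)))"
    using ab pE EB by (intro hdist_residual[OF orthogonal_edge_facets c_in_ball, of p "a + b"]) auto
  then show ?thesis
    using hsetdist_le[of "{c}" E c p] c_in_ball pE EB by simp
qed

text \<open>Exchanging \<open>H\<close> for \<open>F\<close> yields a neighbouring edge whose
  distance from \<open>c\<close> is bounded below by the exchanged coordinate sum, while that of
  \<open>E\<close> is bounded above by the original sum. Outermostness compares the two sums, and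
  their common terms cancel.\<close>

lemma coord_sq_framing_le:
  assumes outer: "outermost_edge P c E" and H: "H \<in> edge_facets P E"
  shows "coord_sq (lift c) (nrm F) \<le> coord_sq (lift c) (nrm H)"
proof -
  let ?q = "\<lambda>K. coord_sq (lift c) (nrm K)" and ?S = "insert F (edge_facets P E - {H})"
  have inj: "inj_on nrm (insert F (edge_facets P E))"
    by (rule inj_on_subset[OF facet_normal_inj]) (use F framing_facet_facet edge_facet_facet in blast)
  have S: "lorentz_orthogonal (nrm ` ?S)"
    by (rule lorentz_orthogonal_subset[OF orthogonal_insert_framing[OF F(1)]]) auto
  obtain E' where E': "E' edge_of P" "\<And>K. K \<in> ?S \<Longrightarrow> E' \<subseteq> K"
    using neighbour_edge[OF F H] by blast
  have E'B: "E' \<subseteq> ball 0 1"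
    using E' edge_of_imp_subset subset_ball by blast
  have "E' \<noteq> {}"
    using E' by (auto simp: edge_of_def)
  have orth: "lorentz u (lift y) = 0" if "u \<in> nrm ` ?S" "y \<in> E'" for u y
  proof -
    obtain K where K: "K \<in> ?S" "u = nrm K" using \<open>u \<in> nrm ` ?S\<close> by auto
    then have "K facet_of P" using F framing_facet_facet edge_facet_facet by blast
    moreover have "y \<in> K" using E'(2)[OF K(1)] that(2) by (rule subsetD)
    ultimately show ?thesis unfolding K(2) using mem_facet_iff by blast
  qed
  let ?K = "\<Sum>u\<in>nrm ` ?S. coord_sq (lift c) u"
    and ?L = "\<Sum>u\<in>nrm ` edge_facets P E. coord_sq (lift c) u" and ?Q = "1 - (norm c)\<^sup>2"
  have Q: "0 < ?Q" using c_in_ball by (rule one_minus_norm_sq_pos)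
  have "arcosh (sqrt (1 + ?K / ?Q)) \<le> hsetdist {c} E'"
    by (rule hsetdist_ge_of_orthogonal[OF S c_in_ball E'B \<open>E' \<noteq> {}\<close> orth])
  also have "\<dots> \<le> hsetdist {c} E"
    using outer E' by (simp add: outermost_edge_def)
  also have "\<dots> \<le> arcosh (sqrt (1 + ?L / ?Q))"
    by (rule hsetdist_edge_le)
  finally have le: "arcosh (sqrt (1 + ?K / ?Q)) \<le> arcosh (sqrt (1 + ?L / ?Q))" .
  have "0 \<le> ?K" "0 \<le> ?L"
    using coord_sq_nonneg[OF S] coord_sq_nonneg[OF orthogonal_edge_facets]
    by (blast intro: sum_nonneg)+
  then have "1 \<le> sqrt (1 + ?K / ?Q)" "1 \<le> sqrt (1 + ?L / ?Q)"
    using Q by simp_all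
  then have "sqrt (1 + ?K / ?Q) \<le> sqrt (1 + ?L / ?Q)"
    using le arcosh_less_iff_real[of "sqrt (1 + ?L / ?Q)" "sqrt (1 + ?K / ?Q)"] by linarith
  then have "?K \<le> ?L"
    using Q by (simp add: divide_le_cancel)
  moreover have "?K = sum ?q ?S"
    by (rule sum.reindex_cong[OF inj_on_subset[OF inj]]) auto
  moreover have "?L = sum ?q (edge_facets P E)"
    by (rule sum.reindex_cong[OF inj_on_subset[OF inj]]) auto
  moreover have "sum ?q ?S = ?q F + sum ?q (edge_facets P E - {H})"
    using finite_edge_facets framing_facet_not_edge[OF F(1)] by simp
  moreover have "sum ?q (edge_facets P E) = ?q H + sum ?q (edge_facets P E - {H})"
    using finite_edge_facets H by (rule sum.remove)
  ultimately show ?thesis by linarith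
qed

lemma sum_coord_sq_ge:
  assumes outer: "outermost_edge P c E"
  shows "(real CARD('n) - 1) * coord_sq (lift c) (nrm F)
    \<le> (\<Sum>u\<in>nrm ` edge_facets P E. coord_sq (lift c) u)"
proof -
  have "0 \<le> coord_sq (lift c) (nrm F)"
    using coord_sq_nonneg[OF orthogonal_insert_framing[OF F(1)]] by blast
  moreover have "real CARD('n) - 1 \<le> real (card (edge_facets P E))"
    using card_edge_facets_ge[OF edge] by linarith
  ultimately have "(real CARD('n) - 1) * coord_sq (lift c) (nrm F)
      \<le> real (card (edge_facets P E)) * coord_sq (lift c) (nrm F)"
    by (rule mult_right_mono[rotated])
  also have "\<dots> \<le> (\<Sum>H\<in>edge_facets P E. coord_sq (lift c) (nrm H))"
    using coord_sq_framing_le[OF outer] by (rule sum_bounded_below)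
  also have "\<dots> = (\<Sum>u\<in>nrm ` edge_facets P E. coord_sq (lift c) u)"
    by (rule sum.reindex_cong[OF inj_on_subset[OF facet_normal_inj], symmetric])
      (auto simp: edge_facet_facet)
  finally show ?thesis .
qed

text \<open>As \<open>v\<close> lies in \<open>F\<close> and \<open>w\<close> in \<open>G\<close>,
  the width is at most the cosh of the length of \<open>E\<close>. Computing the norm of the
  residual in two ways supplies the equation \<open>total\<close> for the arithmetic bound.\<close>

lemma ridge_width_less:
  assumes outer: "outermost_edge P c E"
  shows "ridge_width F G < (real CARD('n) + 1) / (real CARD('n) - 1)"
proof -
  interpret rev: right_angled_framed_edge P E w v G F c by (rule reverse_framed)
  let ?K = "\<Sum>u\<in>nrm ` edge_facets P E. coord_sq (lift c) u"
  define D q1 q2 Q N where "D = 1 - v \<bullet> w" and "q1 = 1 - (norm v)\<^sup>2" and "q2 = 1 - (norm w)\<^sup>2"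
    and "Q = 1 - (norm c)\<^sup>2" and "N = real CARD('n) - 1"
  have pos: "0 < D" "0 < q1" "0 < q2" "0 < Q" "0 < N"
    using one_minus_inner_pos[OF endpoints(3,4)] one_minus_norm_sq_pos[OF endpoints(3)]
      one_minus_norm_sq_pos[OF endpoints(4)] one_minus_norm_sq_pos[OF c_in_ball] dim_ge_3
    by (simp_all add: D_def q1_def q2_def Q_def N_def)
  obtain a b where ab: "res = a *\<^sub>R lift v + b *\<^sub>R lift w" "0 < a" "0 < b"
    by (rule residual_eq)
  have ba: "res = b *\<^sub>R lift w + a *\<^sub>R lift v"
    using ab(1) by (simp add: add.commute)
  have "lorentz res res = - (Q + ?K)"
    by (simp add: lorentz_residual_self[OF orthogonal_edge_facets] lorentz_lift_lift
        dot_square_norm Q_def)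
  moreover have "lorentz res res = - (a\<^sup>2 * q1 + b\<^sup>2 * q2 + 2 * a * b * D)"
    unfolding ab(1) lorentz_linear lorentz_lift_lift inner_commute[of w v]
    by (simp add: D_def q1_def q2_def dot_square_norm power2_eq_square algebra_simps)
  ultimately have total: "Q + ?K = a\<^sup>2 * q1 + b\<^sup>2 * q2 + 2 * a * b * D"
    by linarith
  have D2: "q1 * q2 \<le> D\<^sup>2"
    unfolding D_def q1_def q2_def by (rule one_minus_inner_square_ge[OF endpoints(3,4)])
  have K1: "N * (b\<^sup>2 * ((D\<^sup>2 - q1 * q2) / q1)) \<le> ?K"
    using sum_coord_sq_ge[OF outer]
    unfolding residual_coefficient(2)[OF ab(1)] coord_sq_framing[OF F] N_def D_def q1_def q2_def .
  have K2: "N * (a\<^sup>2 * ((D\<^sup>2 - q1 * q2) / q2)) \<le> ?K"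
    using rev.sum_coord_sq_ge[OF outer]
    unfolding rev.residual_coefficient(2)[OF ba] rev.coord_sq_framing[OF G] N_def D_def q1_def q2_def
    by (simp only: inner_commute[of w v] mult.commute[of "1 - (norm w)\<^sup>2"])
  have FB: "F \<subseteq> ball 0 1" "G \<subseteq> ball 0 1"
    using F(1) G(1) framing_facet_facet facet_of_imp_subset subset_ball by blast+
  have "ridge_width F G \<le> D / sqrt (q1 * q2)"
    using cosh_hsetdist_le[OF FB F(2) G(2)]
    by (simp add: ridge_width_def coshdist_def D_def q1_def q2_def)
  also have "\<dots> < (N + 2) / N"
    by (rule width_bound_arithmetic[OF ab(2,3) pos(2,3,4,5,1) D2 total K1 K2])
  finally show ?thesis by (simp add: N_def add.commute)
qed

end

context hyp_polytope
begin

lemma outermost_ridge_width_less: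
  assumes c: "c \<in> interior P" and outer: "outermost_edge P c E" and ra: "right_angled_ridge P E"
    and F: "F \<in> framing_facets P E" and G: "G \<in> framing_facets P E" and ne: "F \<noteq> G"
  shows "ridge_width F G < (real CARD('n) + 1) / (real CARD('n) - 1)"
proof -
  have edge: "E edge_of P" using outer by (simp add: outermost_edge_def)
  obtain v w where E: "E = closed_segment v w"
    using edge edge_segment by metis
  interpret e: right_angled_edge P E v w
    by unfold_locales (fact edge E ra)+
  interpret rev: right_angled_edge P E w v
    by (rule e.reverse)
  \<comment> \<open>Each endpoint has only one framing facet, so distinct ones belong to different
    endpoints.\<close>
  consider "v \<in> F" "w \<in> G" | "w \<in> F" "v \<in> G"
    using F G ne framing_facets_iff[OF E, of F] framing_facets_iff[OF E, of G]
      e.framing_facet_unique[OF F _ G] rev.framing_facet_unique[OF F _ G] by blast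
  then show ?thesis
  proof cases
    case 1
    then interpret right_angled_framed_edge P E v w F G c
      using F G c by unfold_locales
    show ?thesis by (rule ridge_width_less[OF outer])
  next
    case 2
    then interpret right_angled_framed_edge P E w v F G c
      using F G c by unfold_locales
    show ?thesis by (rule ridge_width_less[OF outer])
  qed
qed

end

section \<open>Right-angled polytopes are simple\<close>

text \<open>A timelike vector with negative product against \<open>lift x\<close> lies in the same
  light cone as \<open>lift x\<close>, so it can be rescaled to a lifted point.\<close>

lemma timelike_snd_pos:
  assumes "x \<in> ball 0 1" "lorentz z z < 0" "lorentz (lift x) z < 0"
  shows "0 < snd z"
proof (rule ccontr)
  assume neg: "\<not> 0 < snd z"
  have "(norm (fst z))\<^sup>2 < (snd z)\<^sup>2"
    using assms(2) by (simp add: lorentz_def dot_square_norm power2_eq_square)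
  then have "norm (fst z) < - snd z"
    using neg abs_le_square_iff[of "snd z" "norm (fst z)"] by simp
  moreover have "\<bar>fst z \<bullet> x\<bar> \<le> norm (fst z)"
    using Cauchy_Schwarz_ineq2[of "fst z" x] assms(1)
      mult_left_le[of "norm x" "norm (fst z)"] by simp
  moreover have "fst z \<bullet> x < snd z"
    using assms(3) by (simp add: lorentz_commute[of _ z] lorentz_lift)
  ultimately show False by linarith
qed

text \<open>Split a linear relation into its positive and negative parts, which represent one vector
  \<open>x\<close>. Obtuseness gives \<open>lorentz x x <= 0\<close>, definiteness on the complement
  of \<open>lift v\<close> gives \<open>x = 0\<close>, and pairing with \<open>lift c\<close>, where
  all terms have one sign, kills every coefficient.\<close>

lemma obtuse_imp_independent:
  fixes A :: "((real^'n) \<times> real) set"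
  assumes fin: "finite A" and v: "v \<in> ball 0 1"
    and at_v: "\<And>u. u \<in> A \<Longrightarrow> lorentz u (lift v) = 0"
    and neg: "\<And>u. u \<in> A \<Longrightarrow> lorentz u (lift c) < 0"
    and obtuse: "\<And>u w. u \<in> A \<Longrightarrow> w \<in> A \<Longrightarrow> u \<noteq> w \<Longrightarrow> lorentz u w \<le> 0"
  shows "independent A"
proof -
  have zero: "s u \<le> 0"
    if u: "u \<in> A" and st: "\<And>u. 0 \<le> s u" "\<And>u. 0 \<le> t u" "\<And>u. s u * t u = 0"
      and eq: "(\<Sum>u\<in>A. s u *\<^sub>R u) = (\<Sum>u\<in>A. t u *\<^sub>R u)" for s t :: "(real^'n) \<times> real \<Rightarrow> real" and u
  proof -
    let ?x = "\<Sum>u\<in>A. s u *\<^sub>R u"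
    have "lorentz ?x ?x = lorentz ?x (\<Sum>w\<in>A. t w *\<^sub>R w)"
      using eq by simp
    also have "\<dots> = (\<Sum>u\<in>A. \<Sum>w\<in>A. s u * t w * lorentz u w)"
      unfolding lorentz_sum_left unfolding lorentz_sum_right
      by (simp add: lorentz_scaleR_left lorentz_scaleR_right ac_simps)
    also have "\<dots> \<le> 0"
    proof (intro sum_nonpos)
      fix u w assume "u \<in> A" "w \<in> A"
      then show "s u * t w * lorentz u w \<le> 0"
        using st(1)[of u] st(2)[of w] st(3)[of u] obtuse[of u w]
        by (cases "u = w") (auto simp: mult_nonneg_nonpos)
    qed
    finally have "lorentz ?x ?x \<le> 0" .
    moreover have "lorentz ?x (lift v) = 0"
      by (simp add: lorentz_sum_left lorentz_scaleR_left at_v)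
    ultimately have "?x = 0"
      using lorentz_pos_of_orthogonal_lift[OF v, of ?x] by force
    then have "(\<Sum>u\<in>A. - (s u * lorentz u (lift c))) = 0"
      using lorentz_sum_left[of "\<lambda>u. s u *\<^sub>R u" A "lift c"]
      by (simp add: lorentz_scaleR_left sum_negf)
    moreover have "0 \<le> - (s u * lorentz u (lift c))" if "u \<in> A" for u
      using neg[OF that] st(1)[of u] by (simp add: mult_nonneg_nonpos)
    ultimately have "s u * lorentz u (lift c) = 0"
      using u fin by (simp add: sum_nonneg_eq_0_iff)
    then show ?thesis
      using neg[OF u] by simp
  qed
  have "r u = 0" if u: "u \<in> A" and r: "(\<Sum>u\<in>A. r u *\<^sub>R u) = 0" for r u
  proof -
    let ?s = "\<lambda>u. max (r u) 0" and ?t = "\<lambda>u. max (- r u) 0"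
    have "(\<Sum>u\<in>A. ?s u *\<^sub>R u) - (\<Sum>u\<in>A. ?t u *\<^sub>R u) = (\<Sum>u\<in>A. r u *\<^sub>R u)"
      unfolding sum_subtractf[symmetric] scaleR_diff_left[symmetric]
      by (intro sum.cong) (auto simp: max_def)
    then have eq: "(\<Sum>u\<in>A. ?s u *\<^sub>R u) = (\<Sum>u\<in>A. ?t u *\<^sub>R u)"
      using r by simp
    have "?s u \<le> 0"
      by (rule zero[OF u _ _ _ eq]) (auto simp: max_def)
    moreover have "?t u \<le> 0"
      by (rule zero[OF u _ _ _ eq[symmetric]]) (auto simp: max_def)
    ultimately show ?thesis by linarith
  qed
  then show ?thesis
    unfolding dependent_finite[OF fin] by blast
qed

text \<open>Descend through facets until the dimension is 1.\<close>

lemma polytope_edge_exists: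
  fixes S :: "'a::euclidean_space set"
  assumes "polytope S" "1 \<le> aff_dim S"
  shows "\<exists>E. E edge_of S"
  using assms
proof (induction "nat (aff_dim S)" arbitrary: S rule: less_induct)
  case less
  show ?case
  proof (cases "aff_dim S = 1")
    case True
    then show ?thesis
      using less.prems by (auto simp: edge_of_def intro: face_of_refl polytope_imp_convex)
  next
    case False
    obtain F where F: "F facet_of S"
      using polytope_facet_exists[of S] less.prems by auto
    then have d: "aff_dim F = aff_dim S - 1" "F face_of S"
      by (auto simp: facet_of_def)
    have "polytope F"
      using d(2) less.prems face_of_polytope_polytope by blast
    then obtain E where "E edge_of F"
      using less.hyps[of F] d False less.prems by auto
    then show ?thesis
      using d(2) face_of_trans by (auto simp: edge_of_def)
  qed
qed

context hyp_polytope
begin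

lemma affine_hull_facet:
  assumes "F facet_of P"
  shows "affine hull F = {x. lorentz (nrm F) (lift x) = 0}"
proof -
  have "affine hull F = {x. fst (nrm F) \<bullet> x = snd (nrm F)}"
  proof (rule affine_dim_equal[OF affine_affine_hull])
    show "affine {x. fst (nrm F) \<bullet> x = snd (nrm F)}" by (rule affine_hyperplane)
    show "affine hull F \<noteq> {}" using assms by (simp add: facet_of_def)
    show "affine hull F \<subseteq> {x. fst (nrm F) \<bullet> x = snd (nrm F)}"
      using facet_normal[OF assms] by (intro hull_minimal affine_hyperplane) auto
    show "aff_dim (affine hull F) = aff_dim {x. fst (nrm F) \<bullet> x = snd (nrm F)}"
      using facet_normal[OF assms] assms aff_dim by (simp add: facet_of_def)
  qed
  then show ?thesis by (simp add: lorentz_lift)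
qed

lemma aff_dim_facet_Int_less:
  assumes "F facet_of P" "G facet_of P" "F \<noteq> G"
  shows "aff_dim (F \<inter> G) < aff_dim P - 1" and "F \<inter> G face_of F" and "F \<inter> G \<noteq> F"
proof -
  show face: "F \<inter> G face_of F"
    using assms by (meson face_of_Int face_of_face facet_of_imp_face_of inf_le1)
  show ne: "F \<inter> G \<noteq> F"
    using facets_subset_imp_eq[OF convex assms(1,2)] assms(3) by blast
  have "convex F"
    using assms(1) face_of_imp_convex facet_of_imp_face_of by blast
  then show "aff_dim (F \<inter> G) < aff_dim P - 1"
    using face_of_aff_dim_lt[OF _ face ne] assms(1) by (simp add: facet_of_def)
qed

text \<open>Within its hyperplane, \<open>F\<close> is cut out by its adjacent facets: a segment
  leaving \<open>F\<close> crosses a facet \<open>K\<close> of \<open>F\<close>, and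
  \<open>K\<close> lies in a further facet of \<open>P\<close>, which is adjacent to
  \<open>F\<close> by dimension.\<close>

lemma mem_facetI:
  assumes F: "F facet_of P" and y: "y \<in> affine hull F"
    and le: "\<And>G. adjacent_facets P F G \<Longrightarrow> lorentz (nrm G) (lift y) \<le> 0"
  shows "y \<in> F"
proof (rule ccontr)
  assume yF: "y \<notin> F"
  have face: "F face_of P" and ne: "F \<noteq> {}"
    using F by (auto simp: facet_of_def)
  have convF: "convex F" and polyF: "polytope F"
    using face face_of_imp_convex face_of_polytope_polytope polytope by blast+
  obtain c where c: "c \<in> rel_interior F"
    using ne convF rel_interior_eq_empty by blast
  obtain K t where K: "K facet_of F" "0 < t" "t < 1" "c + t *\<^sub>R (y - c) \<in> K"
    using polytope_exit_facet[OF polyF c y yF] by blast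
  have Kface: "K face_of P"
    using K(1) face face_of_trans facet_of_imp_face_of by blast
  have KF: "K \<subseteq> F" "K \<noteq> F" and Kne: "K \<noteq> {}" and Kdim: "aff_dim K = aff_dim P - 2"
    using facet_of_imp_subset[OF K(1)] K(1) F by (auto simp: facet_of_def)
  have "K \<noteq> P"
    using Kdim by auto
  then have K_eq: "K = \<Inter>{G. G facet_of P \<and> K \<subseteq> G}"
    using face_of_polyhedron[OF polyhedron Kface Kne] by blast
  \<comment> \<open>\<open>K\<close> is the intersection of the facets of \<open>P\<close>
    containing it; were \<open>F\<close> the only one, then \<open>K = F\<close>.\<close>
  obtain G where G: "G facet_of P" "K \<subseteq> G" "G \<noteq> F"
  proof (rule ccontr)
    assume "\<not> thesis"
    then have "{G. G facet_of P \<and> K \<subseteq> G} = {F}"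
      using that F KF by blast
    then show False using K_eq KF by simp
  qed
  note int = aff_dim_facet_Int_less[OF F G(1) G(3)[symmetric]]
  have "aff_dim K \<le> aff_dim (F \<inter> G)"
    using KF G by (intro aff_dim_subset) blast
  then have "adjacent_facets P F G"
    using int(1) F G Kdim unfolding adjacent_facets_def by auto
  then have "lorentz (nrm G) (lift y) \<le> 0" by (rule le)
  moreover have "c \<notin> G"
    using face_of_disjoint_rel_interior[OF int(2,3)] c rel_interior_subset by blast
  then have "lorentz (nrm G) (lift c) < 0"
    using c rel_interior_subset F facet_of_imp_subset by (intro lorentz_facet_less[OF G(1)]) blast+
  ultimately have "lorentz (nrm G) (lift (c + t *\<^sub>R (y - c))) < 0"
    using lorentz_lift_segment_less K(2,3) by blast
  moreover have "c + t *\<^sub>R (y - c) \<in> G"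
    using K(4) G(2) by blast
  ultimately show False
    using mem_facet_iff[OF G(1)] by simp
qed

end

section \<open>Right angles between all facets through a common point\<close>

locale right_angled_hyp_polytope = hyp_polytope P for P :: "(real^'n) set" +
  assumes right_angled: "right_angled_polytope P"
begin

lemma adjacent_orthogonal:
  assumes adj: "adjacent_facets P F G"
  shows "lorentz (nrm F) (nrm G) = 0"
proof -
  have FG: "F facet_of P" "G facet_of P" "aff_dim (F \<inter> G) = aff_dim P - 2"
    using adj by (auto simp: adjacent_facets_def)
  then have "F \<inter> G \<noteq> {}"
    using aff_dim dim_ge_3 by auto
  then obtain v where "v \<in> F" "v \<in> G" by auto
  moreover have "dihedral_angle P F G = pi / 2"
    using adj right_angled by (simp add: right_angled_polytope_def)
  ultimately show ?thesis
    using lorentz_eq_0_of_right_angle FG by blast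
qed

text \<open>Project a point \<open>x\<close> of \<open>G\<close> outside \<open>F\<close> to the
  hyperplane of \<open>F\<close>. Facets adjacent to \<open>F\<close> are orthogonal to it, so the
  signs of their products are preserved and the image lies in \<open>F\<close>. Being on the inner
  side of \<open>G\<close>, it determines the sign of the product of the normals.\<close>

lemma facets_obtuse:
  assumes F: "F facet_of P" and G: "G facet_of P" and ne: "F \<noteq> G"
  shows "lorentz (nrm F) (nrm G) \<le> 0"
proof -
  obtain x where x: "x \<in> G" "x \<notin> F"
    using facets_subset_imp_eq[OF convex G F] ne by blast
  have xP: "x \<in> P" and Gx: "lorentz (nrm G) (lift x) = 0"
    using mem_facet_iff[OF G] x by auto
  have xB: "x \<in> ball 0 1" using xP subset_ball by blast
  have FF: "0 < lorentz (nrm F) (nrm F)" by (rule facet_normal_spacelike[OF F])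
  have Fx: "lorentz (nrm F) (lift x) < 0" by (rule lorentz_facet_less[OF F xP x(2)])
  define k where "k = lorentz (nrm F) (lift x) / lorentz (nrm F) (nrm F)"
  have k: "k < 0" using Fx FF by (simp add: k_def divide_neg_pos)
  \<comment> \<open>The projection \<open>y\<close> of \<open>x\<close> to the hyperplane of \<open>F\<close> stays in \<open>P\<close>, hence on the inner side of \<open>G\<close>.\<close>
  define z where "z = lift x - k *\<^sub>R nrm F"
  have zF: "lorentz (nrm F) z = 0"
    using FF by (simp add: z_def lorentz_linear k_def)
  have "lorentz (lift x) z = lorentz (lift x) (lift x) - k * lorentz (nrm F) (lift x)"
    by (simp add: z_def lorentz_linear lorentz_commute)
  moreover have "lorentz (lift x) (lift x) < 0"
    using one_minus_norm_sq_pos[OF xB] by (simp add: lorentz_lift_lift dot_square_norm)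
  moreover have "0 < k * lorentz (nrm F) (lift x)"
    using k Fx by (rule mult_neg_neg)
  ultimately have xz: "lorentz (lift x) z < 0" by linarith
  have "lorentz z z = lorentz (lift x) z - k * lorentz (nrm F) z"
    by (subst (1) z_def) (simp add: lorentz_linear)
  then have "lorentz z z < 0" using xz zF by simp
  then have s: "0 < snd z" using timelike_snd_pos[OF xB _ xz] by blast
  define y where "y = (1 / snd z) *\<^sub>R fst z"
  have lift_y: "lift y = (1 / snd z) *\<^sub>R z"
    using s by (simp add: lift_def y_def prod_eq_iff)
  have "y \<in> F"
  proof (rule mem_facetI[OF F])
    show "y \<in> affine hull F"
      unfolding affine_hull_facet[OF F] by (simp add: lift_y lorentz_scaleR_right zF)
  next
    fix H assume adj: "adjacent_facets P F H"
    then have "lorentz (nrm H) (nrm F) = 0"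
      using adjacent_orthogonal lorentz_commute by metis
    then have "lorentz (nrm H) z \<le> 0"
      using lorentz_facet_le[of H x] xP adj by (simp add: z_def lorentz_linear adjacent_facets_def)
    then show "lorentz (nrm H) (lift y) \<le> 0"
      unfolding lift_y lorentz_scaleR_right using s by (simp add: divide_nonpos_pos)
  qed
  then have "lorentz (nrm G) (lift y) \<le> 0"
    using lorentz_facet_le[OF G] F facet_of_imp_subset by blast
  then have "lorentz (nrm G) z \<le> 0"
    unfolding lift_y lorentz_scaleR_right using s by (simp add: divide_le_0_iff)
  then have "0 \<le> k * lorentz (nrm G) (nrm F)"
    by (simp add: z_def lorentz_linear Gx)
  then show ?thesis
    using k by (simp add: zero_le_mult_iff lorentz_commute)
qed

lemma independent_normals_at:
  assumes "v \<in> P"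
  shows "independent (nrm ` {F. F facet_of P \<and> v \<in> F})"
proof -
  obtain c where c: "c \<in> interior P" using interior by auto
  show ?thesis
  proof (rule obtuse_imp_independent)
    show "finite (nrm ` {F. F facet_of P \<and> v \<in> F})"
      using finite_facets by (intro finite_imageI) (rule rev_finite_subset, auto)
    show "v \<in> ball 0 1" using assms subset_ball by blast
    show "lorentz u (lift v) = 0" if "u \<in> nrm ` {F. F facet_of P \<and> v \<in> F}" for u
      using that mem_facet_iff by auto
    show "lorentz u (lift c) < 0" if "u \<in> nrm ` {F. F facet_of P \<and> v \<in> F}" for u
      using that lorentz_interior_less c by auto
    show "lorentz u w \<le> 0" if "u \<in> nrm ` {F. F facet_of P \<and> v \<in> F}"
        "w \<in> nrm ` {F. F facet_of P \<and> v \<in> F}" "u \<noteq> w" for u w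
      using that facets_obtuse by auto
  qed
qed

text \<open>Independence of the normals at \<open>v\<close> yields a direction that is tangent to
  \<open>F\<close> and \<open>G\<close> and points strictly inside every other facet at
  \<open>v\<close>. A small step along it reaches a point around which \<open>F \<inter> G\<close>
  fills the intersection \<open>L\<close> of the two hyperplanes.\<close>

lemma facets_at_point_adjacent:
  assumes F: "F facet_of P" "v \<in> F" and G: "G facet_of P" "v \<in> G" and ne: "F \<noteq> G"
  shows "adjacent_facets P F G"
proof -
  have vP: "v \<in> P" using F facet_of_imp_subset by blast
  let ?A = "nrm ` {F. F facet_of P \<and> v \<in> F}"
  let ?f = "\<lambda>u. if u = nrm F \<or> u = nrm G then 0 else - 1 :: real"
  obtain g where g: "linear g" "\<forall>u\<in>?A. g u = ?f u"
    using linear_independent_extend[OF independent_normals_at[OF vP], of ?f] by blast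
  \<comment> \<open>The vector \<open>adjoint g 1\<close> represents \<open>g\<close> by an inner
    product; its last coordinate is absorbed using
    \<open>snd (nrm H) = fst (nrm H) \<bullet> v\<close>.\<close>
  define d where "d = fst (adjoint g 1) + snd (adjoint g 1) *\<^sub>R v"
  have d: "fst (nrm H) \<bullet> d = (if H = F \<or> H = G then 0 else - 1)" if H: "H facet_of P" "v \<in> H" for H
  proof -
    have "nrm H = nrm K \<longleftrightarrow> H = K" if "K facet_of P" for K
      using facet_normal_inj H that by (auto dest: inj_onD)
    then have "g (nrm H) = (if H = F \<or> H = G then 0 else - 1)"
      using g(2) H F G by simp
    moreover have "g (nrm H) = nrm H \<bullet> adjoint g 1"
      using adjoint_works[OF g(1), of "nrm H" 1] by simp
    moreover have "snd (nrm H) = fst (nrm H) \<bullet> v"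
      using H mem_facet_iff[OF H(1)] by (simp add: lorentz_lift)
    ultimately show ?thesis
      by (simp add: d_def inner_prod_def inner_add_right mult.commute)
  qed
  then have "fst (nrm H) \<bullet> d \<le> 0" if "H facet_of P" "v \<in> H" for H
    using that by simp
  then obtain e where e: "0 < e" "v + e *\<^sub>R d \<in> P"
    using feasible_direction[OF vP] by blast
  \<comment> \<open>Half the step \<open>e\<close>, so that facets not containing \<open>v\<close> are avoided as well.\<close>
  define p where "p = v + (e / 2) *\<^sub>R d"
  define L where "L = {x. fst (nrm F) \<bullet> x = snd (nrm F)} \<inter> {x. fst (nrm G) \<bullet> x = snd (nrm G)}"
  define U where "U = (\<Inter>H\<in>{H. H facet_of P} - {F, G}. {x. fst (nrm H) \<bullet> x < snd (nrm H)})"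
  have "open U"
    unfolding U_def using finite_facets by (intro open_INT open_halfspace_lt ballI) auto
  have on_v: "fst (nrm H) \<bullet> v = snd (nrm H)" if "H facet_of P" "v \<in> H" for H
    using that mem_facet_iff by (simp add: lorentz_lift)
  have "p \<in> L"
    using d[OF F] d[OF G] on_v[OF F] on_v[OF G] by (simp add: L_def p_def inner_add_right)
  moreover have "p \<in> U"
    unfolding U_def
  proof (intro INT_I CollectI)
    fix H assume H: "H \<in> {H. H facet_of P} - {F, G}"
    show "fst (nrm H) \<bullet> p < snd (nrm H)"
    proof (cases "v \<in> H")
      case True
      then show ?thesis
        using d[of H] on_v[of H] H e by (simp add: p_def inner_add_right)
    next
      case False
      then have "lorentz (nrm H) (lift v) < 0" "lorentz (nrm H) (lift (v + e *\<^sub>R d)) \<le> 0"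
        using H lorentz_facet_less lorentz_facet_le e vP by auto
      from lorentz_lift_segment_less[OF this, of "1/2"] show ?thesis
        by (simp add: lorentz_lift p_def)
    qed
  qed
  ultimately have "L \<inter> U \<noteq> {}" by blast
  moreover have affL: "affine L"
    unfolding L_def by (intro affine_Int affine_hyperplane)
  ultimately have "aff_dim (L \<inter> U) = aff_dim L"
    using \<open>open U\<close> affine_imp_convex by (intro aff_dim_convex_Int_open) auto
  moreover have "L \<inter> U \<subseteq> F \<inter> G"
  proof
    fix x assume x: "x \<in> L \<inter> U"
    have "x \<in> P"
    proof (rule mem_polytopeI)
      fix H assume "H facet_of P"
      then have "fst (nrm H) \<bullet> x \<le> snd (nrm H)"
        using x by (cases "H = F \<or> H = G") (force simp: L_def, force simp: U_def)
      then show "lorentz (nrm H) (lift x) \<le> 0"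
        by (simp add: lorentz_lift)
    qed
    then show "x \<in> F \<inter> G"
      using x mem_facet_iff[OF F(1)] mem_facet_iff[OF G(1)] by (simp add: L_def lorentz_lift)
  qed
  then have "aff_dim (L \<inter> U) \<le> aff_dim (F \<inter> G)"
    by (rule aff_dim_subset)
  moreover have "aff_dim L = aff_dim P - 2"
  proof -
    have "v \<in> L" using on_v[OF F] on_v[OF G] by (simp add: L_def)
    moreover have "\<not> {x. fst (nrm F) \<bullet> x = snd (nrm F)} \<subseteq> {x. fst (nrm G) \<bullet> x = snd (nrm G)}"
    proof
      assume "{x. fst (nrm F) \<bullet> x = snd (nrm F)} \<subseteq> {x. fst (nrm G) \<bullet> x = snd (nrm G)}"
      then have "F \<subseteq> G"
        using facet_normal[OF F(1)] facet_normal[OF G(1)] by blast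
      then show False
        using facets_subset_imp_eq[OF convex F(1) G(1)] ne by blast
    qed
    ultimately show ?thesis
      unfolding L_def
      using aff_dim_affine_Int_hyperplane[OF affine_hyperplane, of "fst (nrm F)" "snd (nrm F)"
          "fst (nrm G)" "snd (nrm G)"] facet_normal[OF F(1)] aff_dim
      by auto
  qed
  ultimately have "aff_dim P - 2 \<le> aff_dim (F \<inter> G)" by linarith
  then show ?thesis
    using aff_dim_facet_Int_less(1)[OF F(1) G(1) ne] F G ne by (simp add: adjacent_facets_def)
qed

text \<open>Two facets of the ridge that are not both framing share an endpoint of \<open>E\<close>,
  hence are adjacent.\<close>

lemma right_angled_ridge:
  assumes "E edge_of P"
  shows "right_angled_ridge P E"
  unfolding right_angled_ridge_def
proof (intro ballI impI)
  fix F G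
  assume FG: "F \<in> edge_facets P E \<union> framing_facets P E" "G \<in> edge_facets P E \<union> framing_facets P E"
    "F \<noteq> G \<and> \<not> (F \<in> framing_facets P E \<and> G \<in> framing_facets P E)"
  obtain v w where E: "E = closed_segment v w"
    using assms edge_segment by metis
  obtain x where "F facet_of P" "x \<in> F" "G facet_of P" "x \<in> G"
    using FG edge_facets_iff[OF E] framing_facets_iff[OF E] by blast
  then have "adjacent_facets P F G"
    using facets_at_point_adjacent FG(3) by blast
  then show "dihedral_angle P F G = pi / 2"
    using right_angled by (simp add: right_angled_polytope_def)
qed

end

section \<open>Existence of framing facets and of outermost edges\<close>

context hyp_polytope
begin

text \<open>The vertex \<open>v\<close> is the intersection of the facets through it, so one of
  these misses \<open>w\<close>.\<close>

lemma framing_facet_exists: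
  assumes "E edge_of P" and E: "E = closed_segment v w"
  obtains F where "F \<in> framing_facets P E" "v \<in> F"
proof -
  have face: "E face_of P" and d: "aff_dim E = 1"
    using assms by (auto simp: edge_of_def)
  have "{v} face_of E"
    unfolding face_of_singleton E extreme_point_of_segment by simp
  then have v: "{v} face_of P"
    using face face_of_trans by blast
  have "{v} \<noteq> P"
    using aff_dim dim_ge_3 aff_dim_sing[of v] by auto
  then have eq: "{v} = \<Inter>{F. F facet_of P \<and> {v} \<subseteq> F}"
    using face_of_polyhedron[OF polyhedron v] by blast
  have "v \<noteq> w" using d E by auto
  then have "w \<notin> \<Inter>{F. F facet_of P \<and> {v} \<subseteq> F}"
    unfolding eq[symmetric] by simp
  then obtain F where "F facet_of P" "v \<in> F" "w \<notin> F"
    by auto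
  then show ?thesis
    using that framing_facets_iff[OF E] by blast
qed

lemma outermost_edge_exists: "\<exists>E. outermost_edge P c E"
proof -
  have "finite {E. E edge_of P}"
    by (rule finite_subset[OF _ finite_polytope_faces[OF polytope]]) (auto simp: edge_of_def)
  moreover have "{E. E edge_of P} \<noteq> {}"
    using polytope_edge_exists[OF polytope] aff_dim dim_ge_3 by auto
  \<comment> \<open>The farthest edge is found as a minimiser of the negated distance.\<close>
  ultimately obtain E where "is_arg_min (\<lambda>E. - hsetdist {c} E) (\<lambda>E. E \<in> {E. E edge_of P}) E"
    using ex_is_arg_min_if_finite by blast
  then have "outermost_edge P c E"
    by (auto simp: outermost_edge_def is_arg_min_linorder)
  then show ?thesis by blast
qed

end

text \<open>For the second claim, an edge outermost relative to any chosen interior point is taken;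
  its ridge is right-angled, and each endpoint contributes a framing facet.\<close>

theorem theoremB:
  assumes "CARD('n) \<ge> 3"
  shows
   "(\<forall>(P :: (real^'n) set) c E.
        compact_hyp_polytope P \<and> coxeter_polytope P \<and> c \<in> interior P
        \<and> outermost_edge P c E \<and> right_angled_ridge P E \<longrightarrow>
        (\<forall>F G. F \<in> framing_facets P E \<and> G \<in> framing_facets P E \<and> F \<noteq> G \<longrightarrow>
           ridge_width F G < (real CARD('n) + 1) / (real CARD('n) - 1)))
    \<and> (\<forall>P :: (real^'n) set.
        compact_hyp_polytope P \<and> right_angled_polytope P \<longrightarrow>
        (\<exists>E F G. E edge_of P \<and> F \<in> framing_facets P E \<and> G \<in> framing_facets P E \<and> F \<noteq> G
           \<and> ridge_width F G < (real CARD('n) + 1) / (real CARD('n) - 1)))"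
proof (intro conjI allI impI; elim conjE)
  fix P :: "(real^'n) set" and c E F G
  assume "compact_hyp_polytope P" "c \<in> interior P" "outermost_edge P c E" "right_angled_ridge P E"
    "F \<in> framing_facets P E" "G \<in> framing_facets P E" "F \<noteq> G"
  then show "ridge_width F G < (real CARD('n) + 1) / (real CARD('n) - 1)"
    using assms hyp_polytope.intro hyp_polytope.outermost_ridge_width_less by blast
next
  fix P :: "(real^'n) set"
  assume P: "compact_hyp_polytope P" and ra: "right_angled_polytope P"
  interpret right_angled_hyp_polytope P
    using P ra assms by unfold_locales
  obtain c where c: "c \<in> interior P" using interior by auto
  obtain E where outer: "outermost_edge P c E" using outermost_edge_exists by blast
  then have edge: "E edge_of P" by (simp add: outermost_edge_def)
  obtain v w where E: "E = closed_segment v w"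
    using edge edge_segment by metis
  have E': "E = closed_segment w v"
    using E by (simp add: closed_segment_commute)
  obtain F where F: "F \<in> framing_facets P E" "v \<in> F"
    using framing_facet_exists[OF edge E] by blast
  obtain G where G: "G \<in> framing_facets P E" "w \<in> G"
    using framing_facet_exists[OF edge E'] by blast
  have ne: "F \<noteq> G"
    using F G framing_facets_iff[OF E] by blast
  show "\<exists>E F G. E edge_of P \<and> F \<in> framing_facets P E \<and> G \<in> framing_facets P E \<and> F \<noteq> G
      \<and> ridge_width F G < (real CARD('n) + 1) / (real CARD('n) - 1)"
    using edge F(1) G(1) ne outermost_ridge_width_less[OF c outer right_angled_ridge[OF edge] F(1) G(1) ne]
    by blast
qed

end
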